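(* Let $\{X_n;\ n\geq 1\}$ be a sequence of identically distributed negatively associated random variables, let $X$ be a random variable having the same distribution as the $X_n$, and set $S_n=\sum_{i=1}^{n}X_i$, $n\geq 1$. Let $0<p<2$, $r>1$, $q>0$, and let $$f(x)=\sum_{n\geq 1} n^{r-2}P\left(\max_{1\leq k\leq n}|S_k|>x n^{\frac1p}\right),\quad x>0.$$ Then the following are equivalent: (i) $\displaystyle\sum_{n\geq 1} n^{r-2-\frac{1}{pq}}\,E\left(\max_{1\leq k\leq n}|S_k|^{\frac1q}-\epsilon n^{\frac{1}{pq}}\right)^+<\infty$ for all $\epsilon>0$; (ii) $\displaystyle\int_\epsilon^\infty f(x^q)\,dx<\infty$ for all $\epsilon>0$; (iii) the following moment conditions all hold: $$\begin{cases}E|X|^{\frac1q}<\infty & \text{if } q<\frac{1}{pr},\\ E\left[|X|^{pr}\log^+|X|\right]<\infty & \text{if } q=\frac{1}{pr},\\ E|X|^{pr}<\infty & \text{if } q>\frac{1}{pr},\end{cases}$$ and, when $1\leq p<2$, also $EX=0$.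
   Context: All random variables are real-valued and defined on a common probability space. A finite family of random variables $\{X_i;\ 1\leq i\leq n\}$ is said to be negatively associated (NA) if for every pair of disjoint subsets $A$ and $B$ of $\{1,2,\dots,n\}$, $$\mathrm{Cov}\left(f_1(X_i,\ i\in A),\,f_2(X_j,\ j\in B)\right)\leq 0$$ whenever $f_1$ and $f_2$ are coordinatewise increasing and the covariance exists. An infinite family of random variables is NA if every finite subfamily is NA. Notation: $y^+=\max\{y,0\}$; $\log$ is the natural logarithm and $\log^+ y=\log(\max\{e,y\})$ for $y\geq 0$. Sums, integrals and expectations of nonnegative quantities take values in $[0,\infty]$; in particular $f$ takes values in $[0,\infty]$. The condition $EX=0$ means that $X$ is integrable with mean zero. *)

theory Defs
  imports "HOL-Probability.Probability"
begin

definition covariance :: "'a measure \<Rightarrow> ('a \<Rightarrow> real) \<Rightarrow> ('a \<Rightarrow> real) \<Rightarrow> real" where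
  "covariance M U V =
     (LINT \<omega>|M. (U \<omega> - (LINT \<omega>'|M. U \<omega>')) * (V \<omega> - (LINT \<omega>'|M. V \<omega>')))"

definition covariance_exists :: "'a measure \<Rightarrow> ('a \<Rightarrow> real) \<Rightarrow> ('a \<Rightarrow> real) \<Rightarrow> bool" where
  "covariance_exists M U V \<longleftrightarrow>
     integrable M U \<and> integrable M V \<and> integrable M (\<lambda>\<omega>. U \<omega> * V \<omega>)"

text \<open>A real function on \<open>\<real>\<^sup>A\<close> is a function on the extensional maps \<open>A \<rightarrow>\<^sub>E UNIV\<close>.
  "Increasing" is meant in the weak sense.\<close>

definition coordinatewise_increasing :: "'i set \<Rightarrow> (('i \<Rightarrow> real) \<Rightarrow> real) \<Rightarrow> bool" where
  "coordinatewise_increasing A f \<longleftrightarrow>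
     (\<forall>x \<in> A \<rightarrow>\<^sub>E UNIV. \<forall>y \<in> A \<rightarrow>\<^sub>E UNIV. (\<forall>i\<in>A. x i \<le> y i) \<longrightarrow> f x \<le> f y)"

text \<open>The test functions are Borel: a coordinatewise increasing function of several variables
  need not be. Quantifying over all increasing functions instead would give a condition that
  implies this one and no longer depends only on the joint law of the family.\<close>

definition negatively_associated_finite ::
    "'a measure \<Rightarrow> 'i set \<Rightarrow> ('i \<Rightarrow> 'a \<Rightarrow> real) \<Rightarrow> bool" where
  "negatively_associated_finite M I X \<longleftrightarrow>
     (\<forall>A B f1 f2.
        A \<subseteq> I \<longrightarrow> B \<subseteq> I \<longrightarrow> A \<inter> B = {} \<longrightarrow>
        f1 \<in> borel_measurable (PiM A (\<lambda>_. borel)) \<longrightarrow>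
        f2 \<in> borel_measurable (PiM B (\<lambda>_. borel)) \<longrightarrow>
        coordinatewise_increasing A f1 \<longrightarrow>
        coordinatewise_increasing B f2 \<longrightarrow>
        covariance_exists M (\<lambda>\<omega>. f1 (\<lambda>i\<in>A. X i \<omega>)) (\<lambda>\<omega>. f2 (\<lambda>j\<in>B. X j \<omega>)) \<longrightarrow>
        covariance M (\<lambda>\<omega>. f1 (\<lambda>i\<in>A. X i \<omega>)) (\<lambda>\<omega>. f2 (\<lambda>j\<in>B. X j \<omega>)) \<le> 0)"

definition negatively_associated ::
    "'a measure \<Rightarrow> 'i set \<Rightarrow> ('i \<Rightarrow> 'a \<Rightarrow> real) \<Rightarrow> bool" where
  "negatively_associated M I X \<longleftrightarrow>
     (\<forall>J. finite J \<longrightarrow> J \<subseteq> I \<longrightarrow> negatively_associated_finite M J X)"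

text \<open>Sequences are indexed by \<open>n \<ge> 1\<close>; the value \<open>X 0\<close> is never used.\<close>

definition partial_sum :: "(nat \<Rightarrow> 'a \<Rightarrow> real) \<Rightarrow> nat \<Rightarrow> 'a \<Rightarrow> real" where
  "partial_sum X n \<omega> = (\<Sum>i=1..n. X i \<omega>)"

definition max_partial_sum :: "(nat \<Rightarrow> 'a \<Rightarrow> real) \<Rightarrow> nat \<Rightarrow> 'a \<Rightarrow> real" where
  "max_partial_sum X n \<omega> = Max ((\<lambda>k. \<bar>partial_sum X k \<omega>\<bar>) ` {1..n})"

definition log_plus :: "real \<Rightarrow> real" where
  "log_plus y = ln (max (exp 1) y)"

definition series_from_1 :: "(nat \<Rightarrow> ennreal) \<Rightarrow> ennreal" where
  "series_from_1 a = (\<Sum>n. a (Suc n))"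

definition tail_series ::
    "'a measure \<Rightarrow> (nat \<Rightarrow> 'a \<Rightarrow> real) \<Rightarrow> real \<Rightarrow> real \<Rightarrow> real \<Rightarrow> ennreal" where
  "tail_series M X p r x =
     series_from_1 (\<lambda>n. ennreal (real n powr (r - 2) *
       \<P>(\<omega> in M. max_partial_sum X n \<omega> > x * real n powr (1 / p))))"

end

theory Submission
  imports Defs
begin

text \<open>
  Write \<open>M\<^sub>n\<close> for the maximum of \<open>\<bar>S\<^sub>k\<bar>\<close> over \<open>k \<le> n\<close>.  By Tonelli's theorem the expected excess of
  \<open>M\<^sub>n powr (1 / q)\<close> over \<open>\<epsilon> * n powr (1 / (p * q))\<close> is \<open>n powr (1 / (p * q))\<close> times the integral over
  \<open>x \<ge> \<epsilon>\<close> of the probability that \<open>M\<^sub>n > x powr q * n powr (1 / p)\<close>.  Hence the first two conditions agree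
  for every \<open>\<epsilon>\<close> (lemma \<open>excess_series_eq_nn_integral_tail_series\<close>).

  The remaining equivalence says that \<open>M\<^sub>n\<close> is large essentially only if one summand is large.  If
  \<open>P(M\<^sub>n > y)\<close> is replaced by \<open>n * P(\<bar>X\<bar> > c * y)\<close>, the integrated series becomes the expectation of an
  explicit function of \<open>\<bar>X\<bar>\<close>, whose growth is that of the weight in the moment condition (lemma
  \<open>tail_integral_moment_iff\<close>).  Two inequalities justify the replacement.

  From above, the maximal inequality \<open>maximal_tail\<close> bounds \<open>P(M\<^sub>n > y)\<close> by \<open>n * P(\<bar>X\<bar> > y / K)\<close> plus a term
  decaying like an arbitrarily high power of \<open>n / y powr s\<close>, for some moment order \<open>s > p\<close>.  It comes from
  exponential moments: the maximal prefix sum of a sequence is the positive part of the first variable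
  plus the maximal prefix sum of the others.  These are increasing functions of disjoint sets of
  variables, so negative association makes the exponential moment submultiplicative, without any
  comparison with independent variables (lemma \<open>exp_max_prefix_sum_le\<close>).

  From below, the probability that no summand exceeds \<open>y\<close> is at most the product of the single
  probabilities, so the maximal summand, and with it \<open>M\<^sub>n\<close>, has at least the tail that it would have
  under independence (lemma \<open>mult_tail_le_max_partial_sum\<close>).  Finally, for \<open>p \<ge> 1\<close>, convergence of the
  series forces \<open>M\<^sub>n / n powr (1 / p)\<close> to tend to zero in probability; by the upper bound the same holds
  for the centered sequence, and the two statements are compatible only if the mean vanishes
  (lemma \<open>mean_zero\<close>).
\<close>

section \<open>Negatively associated families\<close>

lemma negatively_associated_finiteD:
  assumes "negatively_associated_finite M J X" "A \<subseteq> J" "B \<subseteq> J" "A \<inter> B = {}"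
    and "f1 \<in> borel_measurable (PiM A (\<lambda>_. borel))" "f2 \<in> borel_measurable (PiM B (\<lambda>_. borel))"
    and "coordinatewise_increasing A f1" "coordinatewise_increasing B f2"
    and "covariance_exists M (\<lambda>\<omega>. f1 (\<lambda>i\<in>A. X i \<omega>)) (\<lambda>\<omega>. f2 (\<lambda>j\<in>B. X j \<omega>))"
  shows "covariance M (\<lambda>\<omega>. f1 (\<lambda>i\<in>A. X i \<omega>)) (\<lambda>\<omega>. f2 (\<lambda>j\<in>B. X j \<omega>)) \<le> 0"
  using assms unfolding negatively_associated_finite_def by blast

context prob_space
begin

lemma covariance_eq_expectation_mult:
  assumes "covariance_exists M U V"
  shows "covariance M U V = expectation (\<lambda>\<omega>. U \<omega> * V \<omega>) - expectation U * expectation V"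
proof -
  have [simp]: "integrable M U" "integrable M V" "integrable M (\<lambda>\<omega>. U \<omega> * V \<omega>)"
    using assms by (auto simp: covariance_exists_def)
  show ?thesis
    unfolding covariance_def
    by (simp add: left_diff_distrib right_diff_distrib prob_space)
qed

lemma negatively_associated_expectation_mult_le:
  assumes "negatively_associated M I X" "finite A" "finite B" "A \<subseteq> I" "B \<subseteq> I" "A \<inter> B = {}"
    and "f1 \<in> borel_measurable (PiM A (\<lambda>_. borel))" "f2 \<in> borel_measurable (PiM B (\<lambda>_. borel))"
    and "coordinatewise_increasing A f1" "coordinatewise_increasing B f2"
    and "covariance_exists M (\<lambda>\<omega>. f1 (\<lambda>i\<in>A. X i \<omega>)) (\<lambda>\<omega>. f2 (\<lambda>j\<in>B. X j \<omega>))"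
  shows "expectation (\<lambda>\<omega>. f1 (\<lambda>i\<in>A. X i \<omega>) * f2 (\<lambda>j\<in>B. X j \<omega>))
       \<le> expectation (\<lambda>\<omega>. f1 (\<lambda>i\<in>A. X i \<omega>)) * expectation (\<lambda>\<omega>. f2 (\<lambda>j\<in>B. X j \<omega>))"
proof -
  have "negatively_associated_finite M (A \<union> B) X"
    using assms(1-5) by (auto simp: negatively_associated_def)
  then have "covariance M (\<lambda>\<omega>. f1 (\<lambda>i\<in>A. X i \<omega>)) (\<lambda>\<omega>. f2 (\<lambda>j\<in>B. X j \<omega>)) \<le> 0"
    by (rule negatively_associated_finiteD[OF _ _ _ assms(6-11)]) auto
  then show ?thesis
    using covariance_eq_expectation_mult[OF assms(11)] by simp
qed

end

lemma measurable_compose_coordinates: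
  assumes "f \<in> borel_measurable (PiM A (\<lambda>_. borel))" and [measurable]: "(g :: real \<Rightarrow> real) \<in> borel_measurable borel"
  shows "(\<lambda>x. f (\<lambda>i\<in>A. g (x i))) \<in> borel_measurable (PiM A (\<lambda>_. borel))"
  by (rule measurable_compose[OF _ assms(1)]) measurable

lemma negatively_associated_compose_mono:
  fixes X :: "'i \<Rightarrow> 'a \<Rightarrow> real"
  assumes na: "negatively_associated M I X" and g: "mono (g :: real \<Rightarrow> real)"
  shows "negatively_associated M I (\<lambda>i \<omega>. g (X i \<omega>))"
  unfolding negatively_associated_def negatively_associated_finite_def
proof (intro allI impI, goal_cases)
  case (1 J A B f1 f2)
  have [measurable]: "g \<in> borel_measurable borel" by (rule borel_measurable_mono[OF g])
  define h :: "'i set \<Rightarrow> (('i \<Rightarrow> real) \<Rightarrow> real) \<Rightarrow> ('i \<Rightarrow> real) \<Rightarrow> real" where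
    "h = (\<lambda>C f x. f (\<lambda>i\<in>C. g (x i)) :: real)"
  have eq: "h C f (\<lambda>i\<in>C. X i \<omega>) = f (\<lambda>i\<in>C. g (X i \<omega>))" for C :: "'i set" and f \<omega>
    unfolding h_def by (auto intro!: arg_cong[where f=f] simp: fun_eq_iff)
  have inc: "coordinatewise_increasing C (h C f)" if "coordinatewise_increasing C f" for C :: "'i set" and f
    unfolding coordinatewise_increasing_def h_def
    using that g by (auto simp: coordinatewise_increasing_def mono_def)
  have meas: "h C f \<in> borel_measurable (PiM C (\<lambda>_. borel))"
    if "f \<in> borel_measurable (PiM C (\<lambda>_. borel))" for C :: "'i set" and f
    unfolding h_def using measurable_compose_coordinates[OF that, of g] by simp
  have ex: "covariance_exists M (\<lambda>\<omega>. h A f1 (\<lambda>i\<in>A. X i \<omega>)) (\<lambda>\<omega>. h B f2 (\<lambda>j\<in>B. X j \<omega>))"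
    using 1 by (simp add: eq)
  have "negatively_associated_finite M J X"
    using na 1 by (auto simp: negatively_associated_def)
  then have "covariance M (\<lambda>\<omega>. h A f1 (\<lambda>i\<in>A. X i \<omega>)) (\<lambda>\<omega>. h B f2 (\<lambda>j\<in>B. X j \<omega>)) \<le> 0"
    by (rule negatively_associated_finiteD)
       (fact 1 ex | rule inc meas, fact 1)+
  then show ?case by (simp add: eq)
qed

text \<open>An order-reversing coordinate change turns increasing test functions into decreasing ones;
  negating both test functions restores monotonicity and leaves the covariance unchanged.\<close>

lemma negatively_associated_uminus:
  fixes X :: "'i \<Rightarrow> 'a \<Rightarrow> real"
  assumes na: "negatively_associated M I X"
  shows "negatively_associated M I (\<lambda>i \<omega>. - X i \<omega>)"
  unfolding negatively_associated_def negatively_associated_finite_def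
proof (intro allI impI, goal_cases)
  case (1 J A B f1 f2)
  define h :: "'i set \<Rightarrow> (('i \<Rightarrow> real) \<Rightarrow> real) \<Rightarrow> ('i \<Rightarrow> real) \<Rightarrow> real" where
    "h = (\<lambda>C f x. - f (\<lambda>i\<in>C. - x i) :: real)"
  have eq: "h C f (\<lambda>i\<in>C. X i \<omega>) = - f (\<lambda>i\<in>C. - X i \<omega>)" for C :: "'i set" and f \<omega>
    unfolding h_def by (auto intro!: arg_cong[where f=f] simp: fun_eq_iff)
  have inc: "coordinatewise_increasing C (h C f)" if "coordinatewise_increasing C f" for C :: "'i set" and f
    unfolding coordinatewise_increasing_def h_def
    using that by (auto simp: coordinatewise_increasing_def)
  have meas: "h C f \<in> borel_measurable (PiM C (\<lambda>_. borel))"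
    if "f \<in> borel_measurable (PiM C (\<lambda>_. borel))" for C :: "'i set" and f
    unfolding h_def using measurable_compose_coordinates[OF that, of uminus] by simp
  have ex: "covariance_exists M (\<lambda>\<omega>. h A f1 (\<lambda>i\<in>A. X i \<omega>)) (\<lambda>\<omega>. h B f2 (\<lambda>j\<in>B. X j \<omega>))"
    using 1 by (auto simp: eq covariance_exists_def)
  have "negatively_associated_finite M J X"
    using na 1 by (auto simp: negatively_associated_def)
  then have "covariance M (\<lambda>\<omega>. h A f1 (\<lambda>i\<in>A. X i \<omega>)) (\<lambda>\<omega>. h B f2 (\<lambda>j\<in>B. X j \<omega>)) \<le> 0"
    by (rule negatively_associated_finiteD)
       (fact 1 ex | rule inc meas, fact 1)+
  also have "covariance M (\<lambda>\<omega>. h A f1 (\<lambda>i\<in>A. X i \<omega>)) (\<lambda>\<omega>. h B f2 (\<lambda>j\<in>B. X j \<omega>)) =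
      covariance M (\<lambda>\<omega>. f1 (\<lambda>i\<in>A. - X i \<omega>)) (\<lambda>\<omega>. f2 (\<lambda>j\<in>B. - X j \<omega>))"
    by (simp add: eq covariance_def algebra_simps)
  finally show ?case .
qed

context prob_space
begin

text \<open>The negated indicator of \<open>{x. \<forall>i\<in>C. x i \<le> y}\<close> is increasing; two such negations cancel in a product,
so the joint probability splits off one factor at a time.\<close>

lemma negatively_associated_prob_all_le:
  fixes X :: "nat \<Rightarrow> 'a \<Rightarrow> real"
  assumes na: "negatively_associated M {1..} X"
    and X: "\<And>n. n \<ge> 1 \<Longrightarrow> X n \<in> borel_measurable M"
  shows "prob {\<omega> \<in> space M. \<forall>i\<in>{1..n}. X i \<omega> \<le> y} \<le> (\<Prod>i=1..n. prob {\<omega> \<in> space M. X i \<omega> \<le> y})"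
proof (induction n)
  case 0
  then show ?case by (simp add: prob_space)
next
  case (Suc n)
  let ?E = "\<lambda>C. {\<omega> \<in> space M. \<forall>i\<in>C. X i \<omega> \<le> y}"
  define f where "f = (\<lambda>C (x :: nat \<Rightarrow> real). - (if \<forall>i\<in>C. x i \<le> y then 1 else 0 :: real))"
  have meas: "f C \<in> borel_measurable (PiM C (\<lambda>_. borel))" if "finite C" for C
  proof -
    have "f C = (\<lambda>x. - (\<Prod>i\<in>C. indicator {..y} (x i)))"
      unfolding f_def using that by (auto simp: fun_eq_iff indicator_def)
    also have "\<dots> \<in> borel_measurable (PiM C (\<lambda>_. borel))"
      by (intro borel_measurable_uminus borel_measurable_prod
            measurable_compose[OF measurable_component_singleton] borel_measurable_indicator) auto
    finally show ?thesis .
  qed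
  have inc: "coordinatewise_increasing C (f C)" for C
    unfolding coordinatewise_increasing_def f_def by simp (meson order_trans)
  have eq: "f C (\<lambda>i\<in>C. X i \<omega>) = - indicator (?E C) \<omega>" if "\<omega> \<in> space M" for C \<omega>
    using that by (simp add: f_def indicator_def)
  have sets: "?E C \<in> sets M" if "finite C" "C \<subseteq> {1..}" for C
    using that X by (intro sets.sets_Collect_finite_All borel_measurable_le) auto
  have int: "integrable M (\<lambda>\<omega>. f C (\<lambda>i\<in>C. X i \<omega>))" if "finite C" "C \<subseteq> {1..}" for C
    by (rule Bochner_Integration.integrable_cong[THEN iffD2, OF refl eq])
       (auto intro!: Bochner_Integration.integrable_minus integrable_real_indicator sets that
         simp: emeasure_eq_measure)
  have E: "expectation (\<lambda>\<omega>. f C (\<lambda>i\<in>C. X i \<omega>)) = - prob (?E C)" if "finite C" "C \<subseteq> {1..}" for C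
    using sets[OF that] by (simp add: Bochner_Integration.integral_cong[OF refl eq])
  let ?A = "{Suc n}" let ?B = "{1..n}"
  have pr: "f ?A (\<lambda>i\<in>?A. X i \<omega>) * f ?B (\<lambda>i\<in>?B. X i \<omega>) = indicator (?E {1..Suc n}) \<omega>"
    if "\<omega> \<in> space M" for \<omega>
    unfolding eq[OF that] using that by (simp add: indicator_def atLeastAtMostSuc_conv)
  have S: "?E {1..Suc n} \<in> sets M" by (rule sets) auto
  have "integrable M (\<lambda>\<omega>. f ?A (\<lambda>i\<in>?A. X i \<omega>) * f ?B (\<lambda>i\<in>?B. X i \<omega>))"
    by (rule Bochner_Integration.integrable_cong[THEN iffD2, OF refl pr])
       (assumption, rule integrable_real_indicator[OF S], simp add: emeasure_eq_measure)
  moreover have "finite ?A" "?A \<subseteq> {1..}" "finite ?B" "?B \<subseteq> {1..}" by auto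
  ultimately have ex: "covariance_exists M (\<lambda>\<omega>. f ?A (\<lambda>i\<in>?A. X i \<omega>)) (\<lambda>\<omega>. f ?B (\<lambda>i\<in>?B. X i \<omega>))"
    unfolding covariance_exists_def by (intro conjI int)
  have "prob (?E {1..Suc n}) = expectation (\<lambda>\<omega>. f ?A (\<lambda>i\<in>?A. X i \<omega>) * f ?B (\<lambda>i\<in>?B. X i \<omega>))"
    using S by (simp only: Bochner_Integration.integral_cong[OF refl pr]) simp
  also have "\<dots> \<le> expectation (\<lambda>\<omega>. f ?A (\<lambda>i\<in>?A. X i \<omega>)) * expectation (\<lambda>\<omega>. f ?B (\<lambda>i\<in>?B. X i \<omega>))"
    by (rule negatively_associated_expectation_mult_le[OF na _ _ _ _ _ meas meas inc inc ex]) auto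
  also have "\<dots> = (- prob (?E ?A)) * (- prob (?E ?B))" by (subst (1 2) E) auto
  also have "\<dots> = prob {\<omega> \<in> space M. X (Suc n) \<omega> \<le> y} * prob (?E ?B)" by simp
  also have "\<dots> \<le> prob {\<omega> \<in> space M. X (Suc n) \<omega> \<le> y} * (\<Prod>i=1..n. prob {\<omega> \<in> space M. X i \<omega> \<le> y})"
    by (intro mult_left_mono Suc) auto
  also have "\<dots> = (\<Prod>i=1..Suc n. prob {\<omega> \<in> space M. X i \<omega> \<le> y})"
    by (subst prod.nat_ivl_Suc') auto
  finally show ?case .
qed

end

text \<open>The maximum of \<open>0\<close> and of the prefix sums of \<open>y k, \<dots>, y (k + m - 1)\<close>, computed from the right by
Lindley's recursion.  The recursion is preferred to an explicit maximum because it separates the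
coordinate \<open>y k\<close> from an increasing function of the later coordinates.\<close>

primrec max_prefix_sum :: "nat \<Rightarrow> nat \<Rightarrow> (nat \<Rightarrow> real) \<Rightarrow> real" where
  "max_prefix_sum 0 k y = 0"
| "max_prefix_sum (Suc m) k y = max 0 (y k + max_prefix_sum m (Suc k) y)"

lemma max_prefix_sum_nonneg: "max_prefix_sum m k y \<ge> 0"
  by (cases m) auto

lemma max_prefix_sum_mono:
  "(\<And>i. i \<in> {k..<k+m} \<Longrightarrow> y i \<le> z i) \<Longrightarrow> max_prefix_sum m k y \<le> max_prefix_sum m k z"
proof (induction m arbitrary: k)
  case (Suc m)
  have "y k + max_prefix_sum m (Suc k) y \<le> z k + max_prefix_sum m (Suc k) z"
    by (intro add_mono Suc) auto
  then show ?case by auto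
qed simp

lemma max_prefix_sum_cong:
  "(\<And>i. i \<in> {k..<k+m} \<Longrightarrow> y i = z i) \<Longrightarrow> max_prefix_sum m k y = max_prefix_sum m k z"
  by (intro antisym max_prefix_sum_mono) auto

lemma sum_le_max_prefix_sum: "j \<le> m \<Longrightarrow> (\<Sum>i=k..<k+j. y i) \<le> max_prefix_sum m k y"
proof (induction m arbitrary: k j)
  case (Suc m)
  show ?case
  proof (cases j)
    case j: (Suc j')
    have "(\<Sum>i=k..<k+j. y i) = y k + (\<Sum>i=Suc k..<Suc k+j'. y i)"
      unfolding j by (subst sum.atLeast_Suc_lessThan) auto
    also have "\<dots> \<le> y k + max_prefix_sum m (Suc k) y"
      using Suc.IH[of j' "Suc k"] Suc.prems j by auto
    finally show ?thesis by auto
  qed (simp add: max_prefix_sum_nonneg del: max_prefix_sum.simps)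
qed simp

lemma max_prefix_sum_le:
  "(\<And>i. y i \<le> b) \<Longrightarrow> 0 \<le> b \<Longrightarrow> max_prefix_sum m k y \<le> real m * b"
proof (induction m arbitrary: k)
  case (Suc m)
  have "y k + max_prefix_sum m (Suc k) y \<le> b + real m * b" by (intro add_mono Suc)
  then show ?case using Suc.prems by (auto simp: algebra_simps)
qed simp

lemma measurable_max_prefix_sum:
  "{k..<k+m} \<subseteq> B \<Longrightarrow> max_prefix_sum m k \<in> borel_measurable (PiM B (\<lambda>_. borel))"
proof (induction m arbitrary: k)
  case (Suc m)
  have [measurable]: "max_prefix_sum m (Suc k) \<in> borel_measurable (PiM B (\<lambda>_. borel))"
    by (rule Suc) (use Suc.prems in auto)
  have [measurable]: "(\<lambda>y. y k) \<in> borel_measurable (PiM B (\<lambda>_. borel :: real measure))"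
    by (rule measurable_component_singleton) (use Suc.prems in auto)
  have "max_prefix_sum (Suc m) k = (\<lambda>y. max 0 (y k + max_prefix_sum m (Suc k) y))" by auto
  then show ?case by simp
next
  case 0
  have "max_prefix_sum 0 k = (\<lambda>_. 0)" by (simp add: fun_eq_iff)
  then show ?case by simp
qed

context prob_space
begin

text \<open>Here negative association is used: the first summand \<open>Y k\<close> and the maximal prefix sum of the
  later ones are increasing functions of disjoint sets of coordinates, so the exponential moment of
  their sum is at most the product.  The positive part in the recursion costs only the additive
  constant \<open>1\<close> at each step, because \<open>exp (max 0 t) \<le> 1 + exp t\<close>; this is where the factor
  \<open>m + 1\<close> comes from, which is harmless against the polynomial tail bounds it will be used with.\<close>

lemma exp_max_prefix_sum_le:
  fixes Y :: "nat \<Rightarrow> 'a \<Rightarrow> real"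
  assumes na: "negatively_associated M {1..} Y"
    and Y: "\<And>n. n \<ge> 1 \<Longrightarrow> Y n \<in> borel_measurable M"
    and b: "\<And>i \<omega>. Y i \<omega> \<le> b" "0 \<le> b" and l: "0 \<le> l"
    and a: "\<And>i. i \<ge> 1 \<Longrightarrow> expectation (\<lambda>\<omega>. exp (l * Y i \<omega>)) \<le> a" "1 \<le> a"
  shows "k \<ge> 1 \<Longrightarrow> integrable M (\<lambda>\<omega>. exp (l * max_prefix_sum m k (\<lambda>i. Y i \<omega>))) \<and>
     expectation (\<lambda>\<omega>. exp (l * max_prefix_sum m k (\<lambda>i. Y i \<omega>))) \<le> (real m + 1) * a ^ m"
proof (induction m arbitrary: k)
  case 0
  then show ?case by (simp add: prob_space)
next
  case (Suc m)
  let ?A = "{k}" let ?B = "{Suc k..<Suc k + m}"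
  let ?f1 = "\<lambda>x. exp (l * x k)" let ?f2 = "\<lambda>x. exp (l * max_prefix_sum m (Suc k) x)"
  have eq2: "max_prefix_sum m (Suc k) (\<lambda>i\<in>?B. Y i \<omega>) = max_prefix_sum m (Suc k) (\<lambda>i. Y i \<omega>)" for \<omega>
    by (rule max_prefix_sum_cong) auto
  have m2: "max_prefix_sum m (Suc k) \<in> borel_measurable (PiM ?B (\<lambda>_. borel))"
    by (rule measurable_max_prefix_sum) auto
  have "(\<lambda>\<omega>. \<lambda>i\<in>?B. Y i \<omega>) \<in> measurable M (PiM ?B (\<lambda>_. borel))"
    by (rule measurable_restrict) (use Suc.prems Y in auto)
  from measurable_compose[OF this m2]
  have [measurable]: "(\<lambda>\<omega>. max_prefix_sum m (Suc k) (\<lambda>i. Y i \<omega>)) \<in> borel_measurable M"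
    by (simp only: eq2)
  have [measurable]: "Y k \<in> borel_measurable M" using Y Suc.prems by auto
  have bd2: "max_prefix_sum m (Suc k) (\<lambda>i. Y i \<omega>) \<le> real m * b" for \<omega>
    by (rule max_prefix_sum_le) (use b in auto)
  have i1: "integrable M (\<lambda>\<omega>. exp (l * Y k \<omega>))"
    by (rule integrable_const_bound[where B="exp (l * b)"]) (auto intro!: mult_left_mono[OF _ l] b)
  have i2: "integrable M (\<lambda>\<omega>. exp (l * max_prefix_sum m (Suc k) (\<lambda>i. Y i \<omega>)))"
    using Suc.IH[of "Suc k"] by auto
  have i12: "integrable M (\<lambda>\<omega>. exp (l * Y k \<omega>) * exp (l * max_prefix_sum m (Suc k) (\<lambda>i. Y i \<omega>)))"
    by (rule integrable_const_bound[where B="exp (l * b) * exp (l * (real m * b))"])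
       (auto simp: exp_add[symmetric] intro!: add_mono mult_left_mono[OF _ l] b bd2)
  have inc1: "coordinatewise_increasing ?A ?f1"
    using l by (auto simp: coordinatewise_increasing_def mult_left_mono)
  have inc2: "coordinatewise_increasing ?B ?f2"
    using l by (auto simp: coordinatewise_increasing_def intro!: mult_left_mono max_prefix_sum_mono)
  have "expectation (\<lambda>\<omega>. ?f1 (\<lambda>i\<in>?A. Y i \<omega>) * ?f2 (\<lambda>i\<in>?B. Y i \<omega>))
      \<le> expectation (\<lambda>\<omega>. ?f1 (\<lambda>i\<in>?A. Y i \<omega>)) * expectation (\<lambda>\<omega>. ?f2 (\<lambda>i\<in>?B. Y i \<omega>))"
  proof (rule negatively_associated_expectation_mult_le[OF na])
    show "?f2 \<in> borel_measurable (PiM ?B (\<lambda>_. borel))" using m2 by measurable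
    show "covariance_exists M (\<lambda>\<omega>. ?f1 (\<lambda>i\<in>?A. Y i \<omega>)) (\<lambda>\<omega>. ?f2 (\<lambda>i\<in>?B. Y i \<omega>))"
      unfolding covariance_exists_def eq2 using i1 i2 i12 by simp
  qed (use Suc.prems inc1 inc2 in auto)
  then have "expectation (\<lambda>\<omega>. exp (l * Y k \<omega>) * exp (l * max_prefix_sum m (Suc k) (\<lambda>i. Y i \<omega>)))
      \<le> expectation (\<lambda>\<omega>. exp (l * Y k \<omega>)) * expectation (\<lambda>\<omega>. exp (l * max_prefix_sum m (Suc k) (\<lambda>i. Y i \<omega>)))"
    unfolding eq2 by simp
  also have "\<dots> \<le> a * ((real m + 1) * a ^ m)"
    by (intro mult_mono a Suc.IH[THEN conjunct2]) (use Suc.prems a in auto)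
  finally have prod: "expectation (\<lambda>\<omega>. exp (l * Y k \<omega>) * exp (l * max_prefix_sum m (Suc k) (\<lambda>i. Y i \<omega>)))
      \<le> (real m + 1) * a ^ Suc m" by (simp add: mult_ac)
  have le: "exp (l * max_prefix_sum (Suc m) k (\<lambda>i. Y i \<omega>))
      \<le> 1 + exp (l * Y k \<omega>) * exp (l * max_prefix_sum m (Suc k) (\<lambda>i. Y i \<omega>))" for \<omega>
  proof -
    have "exp (l * max 0 t) \<le> 1 + exp (l * t)" for t
      by (cases "0 \<le> t") (auto simp: max_def)
    from this[of "Y k \<omega> + max_prefix_sum m (Suc k) (\<lambda>i. Y i \<omega>)"]
    show ?thesis by (simp add: exp_add distrib_left)
  qed
  have int: "integrable M (\<lambda>\<omega>. exp (l * max_prefix_sum (Suc m) k (\<lambda>i. Y i \<omega>)))"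
  proof (rule Bochner_Integration.integrable_bound)
    show "integrable M (\<lambda>\<omega>. 1 + exp (l * Y k \<omega>) * exp (l * max_prefix_sum m (Suc k) (\<lambda>i. Y i \<omega>)))"
      using i12 by simp
    show "(\<lambda>\<omega>. exp (l * max_prefix_sum (Suc m) k (\<lambda>i. Y i \<omega>))) \<in> borel_measurable M"
      unfolding max_prefix_sum.simps by measurable
  next
    have "norm (exp (l * max_prefix_sum (Suc m) k (\<lambda>i. Y i \<omega>)))
      \<le> norm (1 + exp (l * Y k \<omega>) * exp (l * max_prefix_sum m (Suc k) (\<lambda>i. Y i \<omega>)))" for \<omega>
      using le[of \<omega>] by (simp only: real_norm_def abs_exp_cancel)
    then show "AE \<omega> in M. norm (exp (l * max_prefix_sum (Suc m) k (\<lambda>i. Y i \<omega>)))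
      \<le> norm (1 + exp (l * Y k \<omega>) * exp (l * max_prefix_sum m (Suc k) (\<lambda>i. Y i \<omega>)))"
      by simp
  qed
  have "expectation (\<lambda>\<omega>. exp (l * max_prefix_sum (Suc m) k (\<lambda>i. Y i \<omega>)))
      \<le> expectation (\<lambda>\<omega>. 1 + exp (l * Y k \<omega>) * exp (l * max_prefix_sum m (Suc k) (\<lambda>i. Y i \<omega>)))"
    by (rule integral_mono[OF int _ le]) (use i12 in auto)
  also have "\<dots> \<le> 1 + (real m + 1) * a ^ Suc m"
    using prod by (simp add: i12 prob_space)
  also have "\<dots> \<le> a ^ Suc m + (real m + 1) * a ^ Suc m"
    using one_le_power[OF a(2), of "Suc m"] by simp
  finally show ?case using int by (simp add: algebra_simps)
qed

end

section \<open>A maximal tail inequality\<close>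

text \<open>Taylor estimates for \<open>exp\<close> that trade the quadratic error term for a power of any order \<open>s \<le> 2\<close>.  Since
the argument is bounded above by \<open>c\<close>, the price is a factor \<open>exp c\<close>.  For orders \<open>s \<le> 1\<close> the power absorbs
the linear term as well; for larger orders it is too small near \<open>0\<close>.\<close>

lemma exp_le_one_plus_powr:
  fixes v c s :: real
  assumes "v \<le> c" "0 \<le> c" "0 < s" "s \<le> 1"
  shows "exp v \<le> 1 + \<bar>v\<bar> powr s * exp c"
proof -
  consider "v \<le> 0" | "0 < v" "v < 1" | "1 \<le> v" by linarith
  then show ?thesis
  proof cases
    case 1
    then have "exp v \<le> 1" by simp
    then show ?thesis by (smt (verit) mult_nonneg_nonneg powr_ge_zero exp_ge_zero)
  next
    case 2
    have "1 - v \<le> exp (- v)" using exp_ge_add_one_self[of "-v"] by simp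
    then have "(1 - v) * exp v \<le> exp (- v) * exp v" by (intro mult_right_mono) auto
    then have "exp v \<le> 1 + v * exp v" by (simp add: exp_minus field_simps)
    also have "v * exp v \<le> \<bar>v\<bar> powr s * exp c"
    proof (intro mult_mono)
      have "v powr 1 \<le> v powr s" using 2 assms by (intro powr_mono') auto
      then show "v \<le> \<bar>v\<bar> powr s" using 2 by simp
    qed (use 2 assms in auto)
    finally show ?thesis by simp
  next
    case 3
    have "1 * exp v \<le> \<bar>v\<bar> powr s * exp c"
      by (intro mult_mono) (use 3 assms in \<open>auto simp: ge_one_powr_ge_zero\<close>)
    then show ?thesis by simp
  qed
qed

lemma exp_le_one_plus_self_plus_powr:
  fixes v c s :: real
  assumes "v \<le> c" "0 \<le> c" "1 \<le> s" "s \<le> 2"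
  shows "exp v \<le> 1 + v + \<bar>v\<bar> powr s * exp c"
proof -
  have sq_le: "x\<^sup>2 \<le> x powr s" if "0 \<le> x" "x \<le> 1" for x :: real
  proof (cases "x = 0")
    case False
    then have "x powr 2 \<le> x powr s" using that assms by (intro powr_mono') auto
    then show ?thesis using that False by (simp add: powr_numeral)
  qed auto
  have exp_c: "t \<le> t * exp c" if "0 \<le> t" for t :: real
    using mult_left_mono[OF one_le_exp_iff[THEN iffD2, OF assms(2)] that] by simp
  consider "\<bar>v\<bar> \<le> 1" | "v < -1" | "1 < v" by linarith
  then show ?thesis
  proof cases
    case 1
    have "exp v \<le> 1 + v + v\<^sup>2"
    proof (cases "0 \<le> v")
      case True
      then show ?thesis using exp_bound[of v] 1 by auto
    next
      case False
      have "exp (- v) \<ge> 1 + (- v) + (- v)\<^sup>2 / 2"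
        using exp_lower_Taylor_quadratic[of "- v"] False by auto
      then have "exp v * (1 - v + v\<^sup>2 / 2) \<le> exp v * exp (- v)" by (intro mult_left_mono) auto
      also have "\<dots> = 1" by (simp add: exp_minus)
      finally have "exp v \<le> 1 / (1 - v + v\<^sup>2 / 2)"
        using False by (subst pos_le_divide_eq) (auto intro: add_pos_nonneg)
      also have "\<dots> \<le> 1 + v + v\<^sup>2"
      proof -
        have "(1 + v + v\<^sup>2) * (1 - v + v\<^sup>2 / 2) = 1 + v\<^sup>2 / 2 * (1 - v + v\<^sup>2)"
          by (simp add: power2_eq_square field_simps)
        also have "\<dots> \<ge> 1" using False by auto
        finally have "1 \<le> (1 + v + v\<^sup>2) * (1 - v + v\<^sup>2 / 2)" .
        moreover have "1 - v + v\<^sup>2 / 2 > 0" using False by (auto intro: add_pos_nonneg)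
        ultimately show ?thesis by (simp add: divide_le_eq)
      qed
      finally show ?thesis .
    qed
    also have "v\<^sup>2 \<le> \<bar>v\<bar> powr s" using sq_le[of "\<bar>v\<bar>"] 1 by simp
    also have "\<dots> \<le> \<bar>v\<bar> powr s * exp c" by (rule exp_c) simp
    finally show ?thesis by simp
  next
    case 2
    have "exp v \<le> 1" using 2 by simp
    moreover have "\<bar>v\<bar> powr 1 \<le> \<bar>v\<bar> powr s" using 2 assms by (intro powr_mono) auto
    moreover have "\<bar>v\<bar> powr s \<le> \<bar>v\<bar> powr s * exp c" by (rule exp_c) simp
    moreover have "\<bar>v\<bar> powr 1 = - v" using 2 by simp
    ultimately show ?thesis by linarith
  next
    case 3
    have "1 * exp v \<le> \<bar>v\<bar> powr s * exp c"
      by (intro mult_mono) (use 3 assms in \<open>auto simp: ge_one_powr_ge_zero\<close>)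
    then show ?thesis using 3 by simp
  qed
qed

lemma powr_le_two_mult_exp:
  fixes c s :: real
  assumes "0 \<le> c" "0 < s" "s \<le> 2"
  shows "c powr s \<le> 2 * exp c"
proof (cases "c \<le> 1")
  case True
  then have "c powr s \<le> 1" using assms by (intro powr_le1) auto
  then show ?thesis using assms one_le_exp_iff[of c] by linarith
next
  case False
  have "c powr s \<le> c powr 2" using False assms by (intro powr_mono) auto
  also have "\<dots> = c\<^sup>2" using assms False by (simp add: powr_numeral)
  also have "\<dots> \<le> 2 * exp c" using exp_lower_Taylor_quadratic[of c] assms by auto
  finally show ?thesis .
qed

text \<open>For \<open>s > 1\<close> the linear term of the exponential moment has to vanish on its own, through the mean; for
\<open>s \<le> 1\<close> it is dominated by the moment of order \<open>s\<close>.  Treating both ranges as one hypothesis lets the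
cases \<open>p < 1\<close> and \<open>p \<ge> 1\<close> share the maximal inequality.\<close>

definition centered_moment :: "'a measure \<Rightarrow> real \<Rightarrow> ('a \<Rightarrow> real) \<Rightarrow> bool" where
  "centered_moment M s Z \<longleftrightarrow> Z \<in> borel_measurable M \<and> integrable M (\<lambda>\<omega>. \<bar>Z \<omega>\<bar> powr s) \<and>
     0 < s \<and> s \<le> 2 \<and> (s \<le> 1 \<or> integrable M Z \<and> (LINT \<omega>|M. Z \<omega>) = 0)"

lemma centered_moment_uminus: "centered_moment M s Z \<Longrightarrow> centered_moment M s (\<lambda>\<omega>. - Z \<omega>)"
  by (auto simp: centered_moment_def)

context prob_space
begin

text \<open>Truncating from above only keeps the map increasing, hence preserves negative association, and it can
only lower the mean, so the linear term in the expansion of \<open>exp\<close> stays nonpositive for a centered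
variable.\<close>

lemma exp_truncated_le:
  assumes Z: "centered_moment M s Z" and b: "0 < b" and l: "0 \<le> l"
  shows "expectation (\<lambda>\<omega>. exp (l * min (Z \<omega>) b))
    \<le> 1 + l powr s * exp (l * b) * expectation (\<lambda>\<omega>. \<bar>Z \<omega>\<bar> powr s)"
proof -
  have [measurable]: "Z \<in> borel_measurable M" and i: "integrable M (\<lambda>\<omega>. \<bar>Z \<omega>\<bar> powr s)"
    and s: "0 < s" "s \<le> 2" using Z by (auto simp: centered_moment_def)
  let ?K = "l powr s * exp (l * b)"
  have lb: "l * min (Z \<omega>) b \<le> l * b" "0 \<le> l * b" for \<omega> using l b by (auto intro!: mult_left_mono)
  have powr_le: "\<bar>l * min (Z \<omega>) b\<bar> powr s * exp (l * b) \<le> ?K * \<bar>Z \<omega>\<bar> powr s" for \<omega>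
  proof -
    have "\<bar>l * min (Z \<omega>) b\<bar> powr s = l powr s * \<bar>min (Z \<omega>) b\<bar> powr s"
      using l by (simp add: abs_mult powr_mult)
    also have "\<dots> \<le> l powr s * \<bar>Z \<omega>\<bar> powr s"
      using b s by (intro mult_left_mono powr_mono2) auto
    finally show ?thesis by (simp add: mult_right_mono mult_ac)
  qed
  have ie: "integrable M (\<lambda>\<omega>. exp (l * min (Z \<omega>) b))"
    by (rule integrable_const_bound[where B="exp (l * b)"]) (use lb in auto)
  consider "s \<le> 1" | "1 < s" "integrable M Z" "expectation Z = 0"
    using Z unfolding centered_moment_def by (cases "s \<le> 1") auto
  then show ?thesis
  proof cases
    case 1
    have "expectation (\<lambda>\<omega>. exp (l * min (Z \<omega>) b)) \<le> expectation (\<lambda>\<omega>. 1 + ?K * \<bar>Z \<omega>\<bar> powr s)"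
    proof (rule integral_mono[OF ie])
      show "exp (l * min (Z \<omega>) b) \<le> 1 + ?K * \<bar>Z \<omega>\<bar> powr s" for \<omega>
        using exp_le_one_plus_powr[OF lb s(1) 1] powr_le[of \<omega>] by (rule order_trans[OF _ add_left_mono])
    qed (use i in auto)
    then show ?thesis using i by (simp add: prob_space)
  next
    case 2
    have im: "integrable M (\<lambda>\<omega>. min (Z \<omega>) b)"
    proof (rule Bochner_Integration.integrable_bound[OF 2(2)])
      have "norm (min t b) \<le> norm t" for t using b by (simp add: min_def)
      then show "AE \<omega> in M. norm (min (Z \<omega>) b) \<le> norm (Z \<omega>)" by blast
    qed measurable
    have "expectation (\<lambda>\<omega>. exp (l * min (Z \<omega>) b))
      \<le> expectation (\<lambda>\<omega>. 1 + l * min (Z \<omega>) b + ?K * \<bar>Z \<omega>\<bar> powr s)"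
    proof (rule integral_mono[OF ie])
      show "exp (l * min (Z \<omega>) b) \<le> 1 + l * min (Z \<omega>) b + ?K * \<bar>Z \<omega>\<bar> powr s" for \<omega>
        using exp_le_one_plus_self_plus_powr[OF lb less_imp_le[OF 2(1)] s(2), of \<omega>] powr_le[of \<omega>]
        by linarith
    qed (use i im in auto)
    also have "\<dots> = 1 + l * expectation (\<lambda>\<omega>. min (Z \<omega>) b) + ?K * expectation (\<lambda>\<omega>. \<bar>Z \<omega>\<bar> powr s)"
      using i im by (simp add: prob_space)
    also have "expectation (\<lambda>\<omega>. min (Z \<omega>) b) \<le> expectation Z"
      by (rule integral_mono[OF im 2(2)]) auto
    then have "l * expectation (\<lambda>\<omega>. min (Z \<omega>) b) \<le> 0"
      using 2(3) l by (simp add: mult_nonneg_nonpos)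
    finally show ?thesis by simp
  qed
qed

end

locale na_sequence = prob_space M for M :: "'a measure" +
  fixes X :: "nat \<Rightarrow> 'a \<Rightarrow> real" and Z :: "'a \<Rightarrow> real"
  assumes X[measurable]: "\<And>n. n \<ge> 1 \<Longrightarrow> X n \<in> borel_measurable M"
    and Z[measurable]: "Z \<in> borel_measurable M"
    and same_distr: "\<And>n. n \<ge> 1 \<Longrightarrow> distr M borel (X n) = distr M borel Z"
    and na: "negatively_associated M {1..} X"
begin

lemma na_sequence_uminus: "na_sequence M (\<lambda>n \<omega>. - X n \<omega>) (\<lambda>\<omega>. - Z \<omega>)"
proof unfold_locales
  show "distr M borel (\<lambda>\<omega>. - X n \<omega>) = distr M borel (\<lambda>\<omega>. - Z \<omega>)" if "n \<ge> 1" for n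
    using arg_cong[OF same_distr[OF that], of "\<lambda>N. distr N borel uminus"] X[OF that]
    by (simp add: distr_distr comp_def)
qed (use negatively_associated_uminus[OF na] in auto)

lemma na_sequence_diff: "na_sequence M (\<lambda>n \<omega>. X n \<omega> - c) (\<lambda>\<omega>. Z \<omega> - c)"
proof unfold_locales
  show "distr M borel (\<lambda>\<omega>. X n \<omega> - c) = distr M borel (\<lambda>\<omega>. Z \<omega> - c)" if "n \<ge> 1" for n
    using arg_cong[OF same_distr[OF that], of "\<lambda>N. distr N borel (\<lambda>x. x - c)"] X[OF that]
    by (simp add: distr_distr comp_def)
  show "negatively_associated M {1..} (\<lambda>n \<omega>. X n \<omega> - c)"
    by (rule negatively_associated_compose_mono[OF na, where g="\<lambda>x. x - c"]) (auto simp: mono_def)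
qed auto

lemma expectation_eq:
  fixes h :: "real \<Rightarrow> real"
  assumes "n \<ge> 1" and [measurable]: "h \<in> borel_measurable borel"
  shows "expectation (\<lambda>\<omega>. h (X n \<omega>)) = expectation (\<lambda>\<omega>. h (Z \<omega>))"
  using integral_distr[OF X[OF assms(1)] assms(2)] integral_distr[OF Z assms(2)] same_distr[OF assms(1)]
  by simp

lemma prob_eq:
  assumes "n \<ge> 1" and [measurable]: "Measurable.pred borel P"
  shows "prob {\<omega> \<in> space M. P (X n \<omega>)} = prob {\<omega> \<in> space M. P (Z \<omega>)}"
proof -
  have "prob {\<omega> \<in> space M. P (Y \<omega>)} = measure (distr M borel Y) {x. P x}"
    if "Y \<in> borel_measurable M" for Y
    using that by (subst measure_distr) (auto intro!: arg_cong[where f=prob])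
  then show ?thesis using X[OF assms(1)] Z same_distr[OF assms(1)] by simp
qed

lemma measurable_partial_sum[measurable]: "partial_sum X n \<in> borel_measurable M"
  unfolding partial_sum_def[abs_def] by (intro borel_measurable_sum X) auto

text \<open>Either some \<open>X i\<close> exceeds \<open>b\<close>, or all prefix sums coincide with those of the truncated variables,
whose maximum is controlled by its exponential moment and Markov's inequality.\<close>

lemma one_sided_maximal_le:
  assumes mom: "centered_moment M s Z" and b: "0 < b" and l: "0 \<le> l"
  shows "prob {\<omega> \<in> space M. \<exists>k\<in>{1..n}. partial_sum X k \<omega> > y}
    \<le> n * prob {\<omega> \<in> space M. Z \<omega> > b} +
      (real n + 1) * exp (- (l * y)) *
        exp (n * (l powr s * exp (l * b) * expectation (\<lambda>\<omega>. \<bar>Z \<omega>\<bar> powr s)))"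
proof -
  define Y where "Y = (\<lambda>i \<omega>. min (X i \<omega>) b)"
  define a where "a = exp (l powr s * exp (l * b) * expectation (\<lambda>\<omega>. \<bar>Z \<omega>\<bar> powr s))"
  let ?G = "\<lambda>\<omega>. max_prefix_sum n 1 (\<lambda>i. Y i \<omega>)"
  have naY: "negatively_associated M {1..} Y"
    unfolding Y_def
    by (rule negatively_associated_compose_mono[OF na, where g="\<lambda>x. min x b"]) (auto simp: mono_def)
  have Y[measurable]: "Y i \<in> borel_measurable M" if "i \<ge> 1" for i using X[OF that] by (simp add: Y_def)
  have a1: "1 \<le> a" unfolding a_def by simp
  have aY: "expectation (\<lambda>\<omega>. exp (l * Y i \<omega>)) \<le> a" if "i \<ge> 1" for i
  proof -
    have "expectation (\<lambda>\<omega>. exp (l * Y i \<omega>)) = expectation (\<lambda>\<omega>. exp (l * min (Z \<omega>) b))"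
      unfolding Y_def using expectation_eq[OF that, of "\<lambda>x. exp (l * min x b)"] by simp
    also have "\<dots> \<le> a"
      using exp_truncated_le[OF mom b l] exp_ge_add_one_self unfolding a_def by (rule order_trans)
    finally show ?thesis .
  qed
  note G = exp_max_prefix_sum_le[OF naY Y _ _ l aY a1, where b=b and k=1 and m=n]
  have G': "integrable M (\<lambda>\<omega>. exp (l * ?G \<omega>))" "expectation (\<lambda>\<omega>. exp (l * ?G \<omega>)) \<le> (real n + 1) * a ^ n"
    using G b by (auto simp: Y_def)
  have Gm[measurable]: "(\<lambda>\<omega>. exp (l * ?G \<omega>)) \<in> borel_measurable M" using G'(1) by auto
  let ?A = "{\<omega> \<in> space M. \<exists>i\<in>{1..n}. X i \<omega> > b}"
  let ?B = "{\<omega> \<in> space M. exp (l * y) \<le> exp (l * ?G \<omega>)}"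
  have X'[measurable]: "i \<in> {1..n} \<Longrightarrow> X i \<in> borel_measurable M" for i using X by auto
  have A: "?A \<in> sets M" by measurable
  have B: "?B \<in> sets M" by (intro borel_measurable_le Gm borel_measurable_const)
  have "{\<omega> \<in> space M. \<exists>k\<in>{1..n}. partial_sum X k \<omega> > y} \<subseteq> ?A \<union> ?B"
  proof (rule subsetI, elim CollectE conjE bexE)
    fix \<omega> k assume *: "\<omega> \<in> space M" "k \<in> {1..n}" "partial_sum X k \<omega> > y"
    show "\<omega> \<in> ?A \<union> ?B"
    proof (cases "\<exists>i\<in>{1..n}. X i \<omega> > b")
      case False
      then have "partial_sum X k \<omega> = (\<Sum>i=1..<1+k. Y i \<omega>)"
        unfolding partial_sum_def Y_def using *(2) by (intro sum.cong) (auto simp: not_less)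
      also have "\<dots> \<le> ?G \<omega>" by (rule sum_le_max_prefix_sum) (use *(2) in auto)
      finally have "l * y \<le> l * ?G \<omega>" using *(3) l by (intro mult_left_mono) auto
      then show ?thesis using *(1) by simp
    qed (use *(1) in auto)
  qed
  then have "prob {\<omega> \<in> space M. \<exists>k\<in>{1..n}. partial_sum X k \<omega> > y} \<le> prob (?A \<union> ?B)"
    by (intro finite_measure_mono sets.Un A B)
  also have "\<dots> \<le> prob ?A + prob ?B" by (rule measure_Un_le[OF A B])
  also have "prob ?A \<le> (\<Sum>i\<in>{1..n}. prob {\<omega> \<in> space M. X i \<omega> > b})"
  proof -
    have "?A = (\<Union>i\<in>{1..n}. {\<omega> \<in> space M. X i \<omega> > b})" by auto
    then show ?thesis by (simp only:) (intro finite_measure_subadditive_finite, auto)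
  qed
  also have "\<dots> = (\<Sum>i\<in>{1..n}. prob {\<omega> \<in> space M. Z \<omega> > b})"
    by (intro sum.cong refl prob_eq[of _ "\<lambda>x. x > b"]) auto
  also have "prob ?B \<le> expectation (\<lambda>\<omega>. exp (l * ?G \<omega>)) / exp (l * y)"
    by (rule integral_Markov_inequality_measure[OF G'(1), of "{}"]) auto
  also have "\<dots> \<le> (real n + 1) * a ^ n / exp (l * y)" by (intro divide_right_mono G') auto
  also have "\<dots> = (real n + 1) * exp (- (l * y)) *
        exp (n * (l powr s * exp (l * b) * expectation (\<lambda>\<omega>. \<bar>Z \<omega>\<bar> powr s)))"
    unfolding a_def by (simp add: exp_of_nat_mult[symmetric] exp_minus field_simps)
  finally show ?thesis by simp
qed

text \<open>This is an inequality of Fuk--Nagaev type.  With truncation at \<open>b = y / K\<close> the parameter \<open>l = c / b\<close> is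
chosen such that \<open>exp (2 * c) = b powr s / n\<close>: then \<open>exp (- l * y) = exp (- K * c)\<close> is the power \<open>K / 2\<close> of
\<open>n / b powr s\<close>, while the exponent contributed by the moments is \<open>c powr s / exp c\<close> times the moment and
so stays bounded.  As \<open>K\<close> is arbitrary, the second term decays at any prescribed polynomial rate, at
the cost of a constant factor in the argument of the first.\<close>

lemma one_sided_maximal_tail:
  assumes mom: "centered_moment M s Z" and y: "0 < y" and K: "0 < K"
  shows "prob {\<omega> \<in> space M. \<exists>k\<in>{1..n}. partial_sum X k \<omega> > y}
    \<le> n * prob {\<omega> \<in> space M. Z \<omega> > y / K} +
      (real n + 1) * exp (2 * expectation (\<lambda>\<omega>. \<bar>Z \<omega>\<bar> powr s)) * (n / (y / K) powr s) powr (K / 2)"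
proof (cases "n = 0")
  case False
  then have n: "real n > 0" by simp
  define b where "b = y / K"
  have b: "b > 0" using y K by (simp add: b_def)
  define m where "m = expectation (\<lambda>\<omega>. \<bar>Z \<omega>\<bar> powr s)"
  have m: "m \<ge> 0" unfolding m_def by simp
  have s: "0 < s" "s \<le> 2" using mom by (auto simp: centered_moment_def)
  show ?thesis
  proof (cases "b powr s < n")
    \<comment> \<open>Here the second term alone is at least \<open>1\<close>.\<close>
    case True
    have "1 \<le> (real n + 1) * exp (2 * m) * (n / b powr s) powr (K / 2)"
    proof -
      have "1 * 1 * 1 \<le> (real n + 1) * exp (2 * m) * (n / b powr s) powr (K / 2)"
        using True b K m by (intro mult_mono ge_one_powr_ge_zero) auto
      then show ?thesis by simp
    qed
    also have "\<dots> \<le> n * prob {\<omega> \<in> space M. Z \<omega> > b} + \<dots>" by simp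
    finally show ?thesis
      using prob_le_1 unfolding b_def m_def by (rule order_trans[rotated])
  next
    case False
    define c where "c = ln (b powr s / n) / 2"
    have c: "0 \<le> c" unfolding c_def using False n b by (intro divide_nonneg_pos ln_ge_zero) auto
    have ec: "exp c * exp c = b powr s / n"
      unfolding c_def exp_add[symmetric] using n b by simp
    have "n * ((c / b) powr s * exp (c / b * b) * m) = c powr s * m / exp c"
    proof -
      have "b powr s = exp c * exp c * n" using ec n by (simp add: field_simps)
      then show ?thesis using b c n by (simp add: powr_divide)
    qed
    also have "\<dots> \<le> 2 * m"
      using mult_right_mono[OF powr_le_two_mult_exp[OF c s] m] by (simp add: field_simps)
    finally have 1: "exp (n * ((c / b) powr s * exp (c / b * b) * m)) \<le> exp (2 * m)" by simp
    have 2: "exp (- (c / b * y)) = (n / b powr s) powr (K / 2)"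
    proof -
      have "c / b * y = c * K" unfolding b_def using y K by simp
      moreover have "ln (n / b powr s) = - ln (b powr s / n)" using n b by (simp add: ln_div)
      ultimately show ?thesis using n b by (simp add: powr_def c_def)
    qed
    have "prob {\<omega> \<in> space M. \<exists>k\<in>{1..n}. partial_sum X k \<omega> > y}
      \<le> n * prob {\<omega> \<in> space M. Z \<omega> > b} +
      (real n + 1) * exp (- (c / b * y)) * exp (n * ((c / b) powr s * exp (c / b * b) * m))"
      unfolding m_def by (rule one_sided_maximal_le[OF mom b]) (use c b in auto)
    also have "\<dots> \<le> n * prob {\<omega> \<in> space M. Z \<omega> > b} +
      (real n + 1) * exp (- (c / b * y)) * exp (2 * m)"
      by (intro add_left_mono mult_left_mono 1) auto
    finally show ?thesis unfolding 2 unfolding m_def b_def by (simp add: mult_ac)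
  qed
qed simp

lemma max_partial_sum_greater_iff:
  "n \<ge> 1 \<Longrightarrow> max_partial_sum X n \<omega> > y \<longleftrightarrow> (\<exists>k\<in>{1..n}. \<bar>partial_sum X k \<omega>\<bar> > y)"
  unfolding max_partial_sum_def by (subst Max_gr_iff) auto

lemma less_abs_iff: "y < \<bar>t\<bar> \<longleftrightarrow> y < t \<or> y < - t" for y t :: real
  by (auto simp: abs_real_def)

lemma maximal_tail:
  assumes mom: "centered_moment M s Z" and y: "0 < y" and K: "0 < K" and n: "n \<ge> 1"
  shows "prob {\<omega> \<in> space M. max_partial_sum X n \<omega> > y}
    \<le> n * prob {\<omega> \<in> space M. \<bar>Z \<omega>\<bar> > y / K} +
      2 * (real n + 1) * exp (2 * expectation (\<lambda>\<omega>. \<bar>Z \<omega>\<bar> powr s)) * (n / (y / K) powr s) powr (K / 2)"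
proof -
  interpret neg: na_sequence M "\<lambda>n \<omega>. - X n \<omega>" "\<lambda>\<omega>. - Z \<omega>" by (rule na_sequence_uminus)
  let ?Y = "\<lambda>n \<omega>. - X n \<omega>"
  have neg_sum: "partial_sum ?Y k \<omega> = - partial_sum X k \<omega>" for k \<omega>
    by (simp add: partial_sum_def sum_negf)
  let ?A = "{\<omega> \<in> space M. \<exists>k\<in>{1..n}. partial_sum X k \<omega> > y}"
  let ?B = "{\<omega> \<in> space M. \<exists>k\<in>{1..n}. partial_sum ?Y k \<omega> > y}"
  have disj: "{\<omega> \<in> space M. Z \<omega> > y / K} \<inter> {\<omega> \<in> space M. - Z \<omega> > y / K} = {}"
  proof -
    have "\<not> (y / K < Z \<omega> \<and> y / K < - Z \<omega>)" for \<omega> using divide_pos_pos[OF y K] by linarith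
    then show ?thesis by blast
  qed
  have "{\<omega> \<in> space M. max_partial_sum X n \<omega> > y} = ?A \<union> ?B"
    unfolding max_partial_sum_greater_iff[OF n] neg_sum less_abs_iff by blast
  then have "prob {\<omega> \<in> space M. max_partial_sum X n \<omega> > y} = prob (?A \<union> ?B)" by simp
  also have "\<dots> \<le> prob ?A + prob ?B" by (rule measure_Un_le) measurable
  also have "\<dots> \<le> n * (prob {\<omega> \<in> space M. Z \<omega> > y / K} + prob {\<omega> \<in> space M. - Z \<omega> > y / K}) +
      2 * (real n + 1) * exp (2 * expectation (\<lambda>\<omega>. \<bar>Z \<omega>\<bar> powr s)) * (n / (y / K) powr s) powr (K / 2)"
    using one_sided_maximal_tail[OF mom y K, of n]
      neg.one_sided_maximal_tail[OF centered_moment_uminus[OF mom] y K, of n]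
    by (simp add: algebra_simps)
  also have "prob {\<omega> \<in> space M. Z \<omega> > y / K} + prob {\<omega> \<in> space M. - Z \<omega> > y / K} =
      prob ({\<omega> \<in> space M. Z \<omega> > y / K} \<union> {\<omega> \<in> space M. - Z \<omega> > y / K})"
    by (intro finite_measure_Union[symmetric] disj) auto
  also have "{\<omega> \<in> space M. Z \<omega> > y / K} \<union> {\<omega> \<in> space M. - Z \<omega> > y / K} = {\<omega> \<in> space M. \<bar>Z \<omega>\<bar> > y / K}"
    unfolding less_abs_iff by blast
  finally show ?thesis .
qed

end

section \<open>The moment condition as a series of excesses\<close>

text \<open>The partial sums of \<open>n powr (g - 1)\<close> and of \<open>1 / n\<close> are compared with \<open>m powr g\<close> and \<open>ln m\<close> by
  telescoping: each term is bounded by a multiple of an increment of the primitive.  The next estimate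
  concerns the increment from \<open>m - 1\<close> to \<open>m\<close> after division by \<open>m powr g\<close>, with \<open>t = 1 / m\<close>.\<close>

lemma one_minus_powr_ge:
  fixes t g :: real
  assumes "0 \<le> t" "t \<le> 1" "0 < g"
  shows "g / (1 + g) * t \<le> 1 - (1 - t) powr g"
proof (cases "t = 1")
  case False
  have pos: "1 + g * t > 0" using assms by (simp add: add_pos_nonneg)
  have "g * ln (1 - t) \<le> g * (- t)"
    using False assms ln_le_minus_one[of "1 - t"] by (intro mult_left_mono) auto
  then have "(1 - t) powr g \<le> exp (- (g * t))" using False by (simp add: powr_def)
  also have "\<dots> \<le> 1 / (1 + g * t)"
    using exp_ge_add_one_self[of "g * t"] assms
    pos by (simp add: exp_minus inverse_eq_divide frac_le)
  also have "\<dots> = 1 - g * t / (1 + g * t)" using pos by (simp add: field_simps)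
  also have "\<dots> \<le> 1 - g * t / (1 + g)"
    using assms mult_left_mono[of t 1 g]
    by (intro diff_left_mono divide_left_mono mult_pos_pos add_pos_nonneg mult_nonneg_nonneg) auto
  finally show ?thesis by simp
qed (use assms in auto)

lemma sum_powr_le:
  assumes g: "0 < (g :: real)"
  shows "(\<Sum>n=1..m. real n powr (g - 1)) \<le> (1 + g) / g * real m powr g"
proof (induction m)
  case (Suc m)
  let ?N = "real (Suc m)"
  have "g / (1 + g) * (1 / ?N) \<le> 1 - (1 - 1 / ?N) powr g" by (rule one_minus_powr_ge) (use g in auto)
  then have "?N powr g * (g / (1 + g) * (1 / ?N)) \<le> ?N powr g * (1 - (1 - 1 / ?N) powr g)"
    by (intro mult_left_mono) auto
  also have "\<dots> = ?N powr g - (?N * (1 - 1 / ?N)) powr g"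
    by (subst powr_mult) (simp_all add: right_diff_distrib)
  also have "?N * (1 - 1 / ?N) = real m" by (simp add: field_simps)
  also have "?N powr g * (g / (1 + g) * (1 / ?N)) = g / (1 + g) * ?N powr (g - 1)"
    by (simp add: powr_diff)
  finally have "?N powr (g - 1) \<le> (1 + g) / g * (?N powr g - real m powr g)"
    using g by (simp add: field_simps)
  then show ?case using Suc by (simp add: algebra_simps)
qed simp

lemma sum_powr_ge:
  assumes g: "0 < (g :: real)"
  shows "(real m + 1) powr g \<le> 1 + g * exp g * (\<Sum>n=1..m. real n powr (g - 1))"
proof (induction m)
  case (Suc m)
  let ?N = "real (Suc m)"
  have "(?N + 1) powr g = ?N powr g * (1 + 1 / ?N) powr g"
  proof -
    have "?N + 1 = ?N * (1 + 1 / ?N)" by (simp add: distrib_left)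
    then show ?thesis by (simp only: powr_mult)
  qed
  also have "(1 + 1 / ?N) powr g \<le> 1 + g * exp g * (1 / ?N)"
  proof -
    have "ln (1 + 1 / ?N) \<le> 1 / ?N" by (rule ln_add_one_self_le_self) auto
    then have "(1 + 1 / ?N) powr g \<le> exp (g * (1 / ?N))"
      using g mult_left_mono[of "ln (1 + 1 / ?N)" "1 / ?N" g] by (simp add: powr_def)
    also have "\<dots> \<le> 1 + (g * (1 / ?N)) * exp (g * (1 / ?N))"
    proof -
      have e: "exp x \<le> 1 + x * exp x" for x :: real
      proof -
        have "(1 - x) * exp x \<le> exp (- x) * exp x"
          using exp_ge_add_one_self[of "- x"] by (intro mult_right_mono) auto
        then show ?thesis by (simp add: exp_minus algebra_simps)
      qed
      show ?thesis by (rule e)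
    qed
    also have "\<dots> \<le> 1 + (g * (1 / ?N)) * exp g"
    proof -
      have "g * (1 / ?N) \<le> g * 1" using g by (intro mult_left_mono) auto
      then show ?thesis using g by (intro add_left_mono mult_left_mono) auto
    qed
    finally show ?thesis by (simp add: mult_ac)
  qed
  then have "?N powr g * (1 + 1 / ?N) powr g \<le> ?N powr g * (1 + g * exp g * (1 / ?N))"
    by (intro mult_left_mono) auto
  also have "\<dots> = ?N powr g + g * exp g * ?N powr (g - 1)"
    by (simp add: powr_diff distrib_left)
  also have "?N powr g \<le> 1 + g * exp g * (\<Sum>n=1..m. real n powr (g - 1))"
    using Suc by (simp add: add.commute)
  finally show ?case by (simp add: algebra_simps)
qed simp

lemma sum_inverse_le: "m \<ge> 1 \<Longrightarrow> (\<Sum>n=1..m. real n powr - 1) \<le> 1 + ln (real m)"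
proof (induction m rule: dec_induct)
  case (step m)
  have "ln (1 - 1 / real (Suc m)) \<le> - (1 / real (Suc m))"
    using ln_le_minus_one[of "1 - 1 / real (Suc m)"] step by simp
  moreover have "1 - 1 / real (Suc m) = real m / real (Suc m)" by (simp add: field_simps)
  moreover have "ln (real m / real (Suc m)) = ln (real m) - ln (real (Suc m))"
    using step by (intro ln_divide_pos) auto
  moreover have "real (Suc m) powr - 1 = 1 / real (Suc m)"
    by (simp add: powr_minus_divide)
  ultimately show ?case using step.IH by simp
qed simp

lemma sum_inverse_ge: "ln (real m + 1) \<le> (\<Sum>n=1..m. real n powr - 1)"
proof (induction m)
  case (Suc m)
  have "ln (1 + 1 / real (Suc m)) \<le> 1 / real (Suc m)" by (rule ln_add_one_self_le_self) auto
  moreover have "1 + 1 / real (Suc m) = (real (Suc m) + 1) / (real m + 1)" by (simp add: field_simps)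
  moreover have "ln ((real (Suc m) + 1) / (real m + 1)) = ln (real (Suc m) + 1) - ln (real m + 1)"
    by (intro ln_divide_pos) auto
  moreover have "real (Suc m) powr - 1 = 1 / real (Suc m)"
    by (simp add: powr_minus_divide)
  ultimately show ?case using Suc by simp
qed simp

text \<open>With \<open>v\<close> a multiple of \<open>\<bar>Z\<bar> powr (1 / q)\<close> and \<open>\<beta> = 1 / (p * q)\<close>, the expectation of this series is the part
of the integrated tail series that comes from a single large summand.  Only the terms with
\<open>n powr \<beta> < v\<close> are nonzero, so the series is of the order \<open>v\<close> times the sum of \<open>n powr (r - 1 - \<beta>)\<close> over
\<open>n < v powr (1 / \<beta>)\<close>.  That sum is bounded, logarithmic, or a power of \<open>v\<close>, according to the sign of
\<open>r - \<beta>\<close>; this is the origin of the three moment conditions.\<close>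

definition excess_series :: "real \<Rightarrow> real \<Rightarrow> real \<Rightarrow> ennreal" where
  "excess_series r \<beta> v =
    series_from_1 (\<lambda>n. ennreal (real n powr (r - 1 - \<beta>) * max 0 (v - real n powr \<beta>)))"

definition excess_growth :: "real \<Rightarrow> real \<Rightarrow> real \<Rightarrow> real" where
  "excess_growth r \<beta> v = (if r < \<beta> then v else if r = \<beta> then v * log_plus v else v powr (r / \<beta>))"

lemma log_plus_ge_1: "log_plus y \<ge> 1"
  unfolding log_plus_def by (subst ln_ge_iff) (auto simp: max_def intro: less_le_trans[OF exp_gt_zero])

lemma log_plus_ge_ln: "0 < y \<Longrightarrow> log_plus y \<ge> ln y"
  unfolding log_plus_def by (subst ln_le_cancel_iff) (auto simp: max_def intro: less_le_trans[OF exp_gt_zero])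

lemma log_plus_le: "1 \<le> y \<Longrightarrow> log_plus y \<le> 1 + ln y"
  unfolding log_plus_def by (cases "exp 1 \<le> y") auto

lemma excess_growth_nonneg: "0 \<le> v \<Longrightarrow> 0 \<le> excess_growth r \<beta> v"
  using log_plus_ge_1[of v] by (auto simp: excess_growth_def)

lemma excess_series_le:
  assumes \<beta>: "0 < \<beta>"
  shows "\<exists>C\<ge>0. \<forall>v\<ge>0. excess_series r \<beta> v \<le> ennreal (C * excess_growth r \<beta> v)"
proof -
  define S where "S = (\<lambda>m. \<Sum>n=1..m. real n powr (r - \<beta> - 1))"
  have main: "excess_series r \<beta> v \<le> ennreal (v * S (nat \<lfloor>v powr (1 / \<beta>)\<rfloor>))" if "0 \<le> v" for v
  proof -
    define m where "m = nat \<lfloor>v powr (1 / \<beta>)\<rfloor>"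
    let ?a = "\<lambda>n. ennreal (real n powr (r - 1 - \<beta>) * max 0 (v - real n powr \<beta>))"
    have zero: "?a (Suc n) = 0" if "n \<notin> {..<m}" for n
    proof -
      have "v powr (1 / \<beta>) \<le> real (Suc n)" using that unfolding m_def by (simp; linarith)
      then have "(v powr (1 / \<beta>)) powr \<beta> \<le> real (Suc n) powr \<beta>" using \<beta> by (intro powr_mono2) auto
      then have "v \<le> real (Suc n) powr \<beta>" using \<beta> \<open>0 \<le> v\<close> by (simp add: powr_powr)
      then show ?thesis by simp
    qed
    have "excess_series r \<beta> v = (\<Sum>n<m. ?a (Suc n))"
      unfolding excess_series_def series_from_1_def by (rule suminf_finite) (use zero in auto)
    also have "\<dots> \<le> (\<Sum>n<m. ennreal (v * real (Suc n) powr (r - \<beta> - 1)))"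
    proof (intro sum_mono ennreal_leI)
      fix n
      have "real (Suc n) powr (r - 1 - \<beta>) * max 0 (v - real (Suc n) powr \<beta>) \<le>
        real (Suc n) powr (r - 1 - \<beta>) * v"
        using \<open>0 \<le> v\<close> by (intro mult_left_mono) auto
      then show "real (Suc n) powr (r - 1 - \<beta>) * max 0 (v - real (Suc n) powr \<beta>) \<le>
        v * real (Suc n) powr (r - \<beta> - 1)" by (simp add: algebra_simps)
    qed
    also have "\<dots> = ennreal (\<Sum>n<m. v * real (Suc n) powr (r - \<beta> - 1))"
      by (rule sum_ennreal) (use \<open>0 \<le> v\<close> in auto)
    also have "(\<Sum>n<m. v * real (Suc n) powr (r - \<beta> - 1)) = v * S m"
      unfolding S_def sum_distrib_left[symmetric]
      by (simp add: sum.atLeast1_atMost_eq)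
    finally show ?thesis unfolding m_def .
  qed
  have zero: "excess_series r \<beta> v \<le> 0" if "0 \<le> v" "v < 1" for v
  proof -
    have "v powr (1 / \<beta>) < 1 powr (1 / \<beta>)" using that \<beta> by (intro powr_less_mono2) auto
    then have "nat \<lfloor>v powr (1 / \<beta>)\<rfloor> = 0" by (simp add: floor_less_iff nat_eq_iff2)
    then show ?thesis using main[OF that(1)] by (simp add: S_def)
  qed
  have "\<exists>C\<ge>0. \<forall>v\<ge>1. v * S (nat \<lfloor>v powr (1 / \<beta>)\<rfloor>) \<le> C * excess_growth r \<beta> v"
  proof -
    have m: "1 \<le> nat \<lfloor>v powr (1 / \<beta>)\<rfloor>" "real (nat \<lfloor>v powr (1 / \<beta>)\<rfloor>) \<le> v powr (1 / \<beta>)" if "1 \<le> v" for v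
    proof -
      have "1 \<le> v powr (1 / \<beta>)" using that \<beta> by (intro ge_one_powr_ge_zero) auto
      then show "1 \<le> nat \<lfloor>v powr (1 / \<beta>)\<rfloor>" by (intro le_nat_floor) (simp only: of_nat_1)
      show "real (nat \<lfloor>v powr (1 / \<beta>)\<rfloor>) \<le> v powr (1 / \<beta>)" by (rule of_nat_floor) simp
    qed
    consider "r < \<beta>" | "r = \<beta>" | "\<beta> < r" by linarith
    then show ?thesis
    proof cases
      case 1
      have summ: "summable (\<lambda>n. real n powr (r - \<beta> - 1))" using 1 by (simp add: summable_real_powr_iff)
      have "S m \<le> (\<Sum>n. real n powr (r - \<beta> - 1))" for m
        unfolding S_def by (rule sum_le_suminf[OF summ]) auto
      then have "v * S (nat \<lfloor>v powr (1 / \<beta>)\<rfloor>) \<le> (\<Sum>n. real n powr (r - \<beta> - 1)) * excess_growth r \<beta> v" if "1 \<le> v" for v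
        using that 1 by (auto simp: excess_growth_def mult.commute intro!: mult_right_mono)
      then show ?thesis using suminf_nonneg[OF summ] by auto
    next
      case 2
      have "v * S (nat \<lfloor>v powr (1 / \<beta>)\<rfloor>) \<le> (1 + 1 / \<beta>) * excess_growth r \<beta> v" if "1 \<le> v" for v
      proof -
        let ?m = "nat \<lfloor>v powr (1 / \<beta>)\<rfloor>"
        have "S ?m \<le> 1 + ln (real ?m)" unfolding S_def using sum_inverse_le[OF m(1)[OF that]] 2 by simp
        also have "ln (real ?m) \<le> ln (v powr (1 / \<beta>))"
          using m[OF that] by (intro ln_mono) linarith+
        also have "\<dots> = 1 / \<beta> * ln v" using that by (simp add: ln_powr)
        also have "\<dots> \<le> 1 / \<beta> * log_plus v" using that \<beta> log_plus_ge_ln[of v] by (intro mult_left_mono) auto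
        also have "1 + 1 / \<beta> * log_plus v \<le> (1 + 1 / \<beta>) * log_plus v"
          using log_plus_ge_1[of v] by (simp add: distrib_right)
        finally have "v * S ?m \<le> v * ((1 + 1 / \<beta>) * log_plus v)" using that by (intro mult_left_mono) auto
        then show ?thesis using 2 by (simp add: excess_growth_def mult_ac)
      qed
      then show ?thesis using \<beta> by (intro exI[of _ "1 + 1 / \<beta>"]) auto
    next
      case 3
      let ?g = "r - \<beta>"
      have "v * S (nat \<lfloor>v powr (1 / \<beta>)\<rfloor>) \<le> (1 + ?g) / ?g * excess_growth r \<beta> v" if "1 \<le> v" for v
      proof -
        let ?m = "nat \<lfloor>v powr (1 / \<beta>)\<rfloor>"
        have "S ?m \<le> (1 + ?g) / ?g * real ?m powr ?g" unfolding S_def by (rule sum_powr_le) (use 3 in simp)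
        also have "\<dots> \<le> (1 + ?g) / ?g * (v powr (1 / \<beta>)) powr ?g"
          using 3 by (intro mult_left_mono powr_mono2 m(2)[OF that]) auto
        finally have "v * S ?m \<le> v * ((1 + ?g) / ?g * (v powr (1 / \<beta>)) powr ?g)"
          using that by (intro mult_left_mono) auto
        also have "\<dots> = (1 + ?g) / ?g * (v powr 1 * v powr (1 / \<beta> * ?g))"
          using that by (simp add: powr_powr mult_ac)
        also have "v powr 1 * v powr (1 / \<beta> * ?g) = v powr (r / \<beta>)"
          using \<beta> by (subst powr_add[symmetric]) (simp add: field_simps)
        finally show ?thesis using 3 by (simp add: excess_growth_def)
      qed
      then show ?thesis using 3 by (intro exI[of _ "(1 + ?g) / ?g"]) auto
    qed
  qed
  then obtain C where C: "C \<ge> 0" "\<And>v. 1 \<le> v \<Longrightarrow> v * S (nat \<lfloor>v powr (1 / \<beta>)\<rfloor>) \<le> C * excess_growth r \<beta> v"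
    by blast
  have "excess_series r \<beta> v \<le> ennreal (C * excess_growth r \<beta> v)" if "0 \<le> v" for v
  proof (cases "v < 1")
    case True
    then show ?thesis using zero[OF that] by simp
  next
    case False
    then show ?thesis using main[OF that] C(2)[of v] by (auto intro: order_trans ennreal_leI)
  qed
  then show ?thesis using C(1) by blast
qed

lemma ennreal_combination_le:
  fixes a b g A B :: real
  assumes "g \<le> A * (1 + a) + B * b" "0 \<le> a" "0 \<le> b" "0 \<le> A" "0 \<le> B"
    and "ennreal a \<le> E" "ennreal b \<le> E"
  shows "ennreal g \<le> ennreal (A + B) * (1 + E)"
proof -
  have "ennreal g \<le> ennreal (A * (1 + a) + B * b)" by (rule ennreal_leI) fact
  also have "\<dots> = ennreal A * (1 + ennreal a) + ennreal B * ennreal b"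
    using assms(2-5) by (simp add: ennreal_mult)
  also have "\<dots> \<le> ennreal A * (1 + E) + ennreal B * (1 + E)"
    by (intro add_mono mult_left_mono add_left_mono add_increasing assms) auto
  also have "\<dots> = ennreal (A + B) * (1 + E)" using assms(4,5) by (simp add: distrib_right)
  finally show ?thesis .
qed

text \<open>For the indices up to \<open>N = (v / 2) powr (1 / \<beta>)\<close> the excess is at least \<open>v / 2\<close>, so this block of terms
already has the right order.  The first term of the series, \<open>max 0 (v - 1)\<close>, accounts for what is
linear in \<open>v\<close>, and the additive constant for small \<open>v\<close>.\<close>

lemma excess_growth_le:
  assumes \<beta>: "0 < \<beta>"
  shows "\<exists>C\<ge>0. \<forall>v\<ge>0. ennreal (excess_growth r \<beta> v) \<le> ennreal C * (1 + excess_series r \<beta> v)"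
proof -
  define S where "S = (\<lambda>m. \<Sum>n=1..m. real n powr (r - \<beta> - 1))"
  have S0: "S m \<ge> 0" for m unfolding S_def by (intro sum_nonneg) auto
  define N where "N = (\<lambda>v. (v / 2) powr (1 / \<beta>))"
  define m where "m = (\<lambda>v. nat \<lfloor>N v\<rfloor>)"
  have partial: "ennreal (\<Sum>n=1..k. real n powr (r - 1 - \<beta>) * max 0 (v - real n powr \<beta>)) \<le> excess_series r \<beta> v" for k v
  proof -
    let ?a = "\<lambda>n. real n powr (r - 1 - \<beta>) * max 0 (v - real n powr \<beta>)"
    have "ennreal (\<Sum>n=1..k. ?a n) = (\<Sum>n<k. ennreal (?a (Suc n)))"
      by (simp add: sum.atLeast1_atMost_eq sum_ennreal)
    also have "\<dots> \<le> excess_series r \<beta> v"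
      unfolding excess_series_def series_from_1_def by (rule sum_le_suminf) auto
    finally show ?thesis .
  qed
  have first: "ennreal (max 0 (v - 1)) \<le> excess_series r \<beta> v" for v using partial[where k=1 and v=v] by simp
  have block: "ennreal (v / 2 * S (m v)) \<le> excess_series r \<beta> v" if "0 \<le> v" for v
  proof -
    have "v / 2 * S (m v) \<le> (\<Sum>n=1..m v. real n powr (r - 1 - \<beta>) * max 0 (v - real n powr \<beta>))"
      unfolding S_def sum_distrib_left
    proof (intro sum_mono)
      fix n assume n: "n \<in> {1..m v}"
      have "N v \<ge> 0" by (simp add: N_def)
      have "real n \<le> N v" using n \<open>N v \<ge> 0\<close> unfolding m_def by (simp add: le_nat_iff le_floor_iff)
      then have "real n powr \<beta> \<le> N v powr \<beta>" using \<beta> by (intro powr_mono2) auto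
      also have "\<dots> = v / 2" using \<beta> that by (simp add: N_def powr_powr)
      finally have "v / 2 \<le> max 0 (v - real n powr \<beta>)" by (intro max.coboundedI2) linarith
      then have "v / 2 * real n powr (r - \<beta> - 1) \<le> max 0 (v - real n powr \<beta>) * real n powr (r - \<beta> - 1)"
        by (intro mult_right_mono) auto
      then show "v / 2 * real n powr (r - \<beta> - 1) \<le> real n powr (r - 1 - \<beta>) * max 0 (v - real n powr \<beta>)"
        by (simp add: algebra_simps)
    qed
    then show ?thesis using partial by (blast intro: order_trans ennreal_leI)
  qed
  have mN: "N v \<le> real (m v) + 1" for v
    unfolding m_def by linarith
  have "\<exists>A\<ge>0. \<exists>B\<ge>0. \<forall>v\<ge>0. excess_growth r \<beta> v \<le> A * (1 + max 0 (v - 1)) + B * (v / 2 * S (m v))"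
  proof -
    consider "r < \<beta>" | "r = \<beta>" | "\<beta> < r" by linarith
    then show ?thesis
    proof cases
      case 1
      then show ?thesis by (intro exI[of _ 1] exI[of _ 0] conjI) (auto simp: excess_growth_def)
    next
      case 2
      have "excess_growth r \<beta> v \<le> 2 * (1 + max 0 (v - 1)) + (2 * \<beta>) * (v / 2 * S (m v))" if "0 \<le> v" for v
      proof (cases "v < 2")
        case True
        then have "log_plus v = 1" using exp_ge_add_one_self[of 1] by (simp add: log_plus_def max_def)
        moreover have "0 \<le> (2 * \<beta>) * (v / 2 * S (m v))" using \<beta> that S0 by (intro mult_nonneg_nonneg) auto
        moreover have "v \<le> 2 * (1 + max 0 (v - 1))" using True by (simp add: max_def)
        moreover have "excess_growth r \<beta> v = v * log_plus v" using 2 by (simp add: excess_growth_def)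
        ultimately show ?thesis by (simp only: mult_1_right add_increasing2)
      next
        case False
        have "1 \<le> N v" unfolding N_def using False \<beta> by (intro ge_one_powr_ge_zero) auto
        have "ln v = ln 2 + \<beta> * ln (N v)" unfolding N_def using False \<beta> by (simp add: ln_powr ln_div)
        also have "ln (2::real) \<le> 1" using ln_le_minus_one[of "2::real"] by simp
        also have "ln (N v) \<le> ln (real (m v) + 1)" using mN[of v] \<open>1 \<le> N v\<close> by (intro ln_mono) auto
        also have "\<dots> \<le> S (m v)" using sum_inverse_ge[of "m v"] 2 by (simp add: S_def)
        finally have "ln v \<le> 1 + \<beta> * S (m v)" using \<beta> by simp
        then have "log_plus v \<le> 2 + \<beta> * S (m v)" using log_plus_le[of v] False by simp
        then have "v * log_plus v \<le> v * (2 + \<beta> * S (m v))" using that by (intro mult_left_mono) auto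
        then show ?thesis using False 2 by (simp add: excess_growth_def algebra_simps)
      qed
      then show ?thesis using \<beta> by (intro exI[of _ 2] exI[of _ "2 * \<beta>"] conjI) auto
    next
      case 3
      let ?g = "r - \<beta>" let ?D = "2 powr (?g / \<beta>)"
      have "excess_growth r \<beta> v \<le> ?D * (1 + max 0 (v - 1)) + (?D * (2 * (?g * exp ?g))) * (v / 2 * S (m v))" if "0 \<le> v" for v
      proof (cases "v = 0")
        case True
        then show ?thesis using 3 \<beta> by (simp add: excess_growth_def)
      next
        case False
        have "v powr (r / \<beta>) = v powr (1 + ?g / \<beta>)" using \<beta> by (simp add: field_simps)
        also have "\<dots> = v * v powr (?g / \<beta>)" using False that by (simp add: powr_add)
        also have "v powr (?g / \<beta>) = ?D * (v / 2) powr (?g / \<beta>)"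
          using that by (simp add: powr_divide)
        also have "(v / 2) powr (?g / \<beta>) = N v powr ?g" by (simp add: N_def powr_powr)
        also have "v * (?D * N v powr ?g) \<le> v * (?D * (1 + ?g * exp ?g * S (m v)))"
        proof -
          have "N v powr ?g \<le> (real (m v) + 1) powr ?g"
            using mN[of v] 3 by (intro powr_mono2) (auto simp: N_def)
          also have "\<dots> \<le> 1 + ?g * exp ?g * S (m v)" unfolding S_def by (rule sum_powr_ge) (use 3 in simp)
          finally show ?thesis using that by (intro mult_left_mono) auto
        qed
        also have "\<dots> = ?D * v + (?D * (2 * (?g * exp ?g))) * (v / 2 * S (m v))"
          by (simp add: algebra_simps)
        also have "?D * v \<le> ?D * (1 + max 0 (v - 1))" by (intro mult_left_mono) auto
        finally show ?thesis using 3 by (simp add: excess_growth_def)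
      qed
      then show ?thesis using 3
        by (intro exI[of _ ?D] exI[of _ "?D * (2 * (?g * exp ?g))"] conjI) auto
    qed
  qed
  then obtain A B where AB: "A \<ge> 0" "B \<ge> 0"
    "\<And>v. v \<ge> 0 \<Longrightarrow> excess_growth r \<beta> v \<le> A * (1 + max 0 (v - 1)) + B * (v / 2 * S (m v))"
    by blast
  have "ennreal (excess_growth r \<beta> v) \<le> ennreal (A + B) * (1 + excess_series r \<beta> v)" if "0 \<le> v" for v
    by (rule ennreal_combination_le[OF AB(3)[OF that] _ _ AB(1,2) first block[OF that]])
       (use that S0 in auto)
  then show ?thesis using AB(1,2) by (intro exI[of _ "A + B"]) auto
qed

lemma log_plus_scale_le:
  assumes k: "0 < k" and a: "0 < a" and z: "0 \<le> z"
  shows "log_plus (k * z powr a) \<le> (1 + \<bar>ln k\<bar> + a) * log_plus z"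
proof (cases "exp 1 \<le> k * z powr a")
  case False
  then have "log_plus (k * z powr a) = 1" by (simp add: log_plus_def max_def)
  moreover have "1 * 1 \<le> (1 + \<bar>ln k\<bar> + a) * log_plus z"
    using a log_plus_ge_1[of z] by (intro mult_mono) auto
  ultimately show ?thesis by simp
next
  case True
  then have "0 < k * z powr a" using exp_gt_zero[of "1::real"] by linarith
  then have z': "0 < z" using z by (cases "z = 0") auto
  have "log_plus (k * z powr a) = ln k + a * ln z"
    using True k z' by (simp add: log_plus_def max_def ln_mult)
  also have "\<dots> \<le> \<bar>ln k\<bar> * log_plus z + a * log_plus z"
    using log_plus_ge_1[of z] log_plus_ge_ln[OF z'] a mult_left_mono[of 1 "log_plus z" "\<bar>ln k\<bar>"]
    by (intro add_mono mult_left_mono) auto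
  also have "\<dots> \<le> (1 + \<bar>ln k\<bar> + a) * log_plus z"
    using log_plus_ge_1[of z] by (simp add: distrib_right)
  finally show ?thesis .
qed

definition moment_weight :: "real \<Rightarrow> real \<Rightarrow> real \<Rightarrow> real \<Rightarrow> real" where
  "moment_weight p r q z =
    (if q < 1 / (p * r) then z powr (1 / q)
     else if q = 1 / (p * r) then z powr (p * r) * log_plus z
     else z powr (p * r))"

text \<open>The constant \<open>k\<close> collects \<open>\<epsilon>\<close> and the scale of \<open>Z\<close>.  Powers simply scale; the logarithm is handled by
substituting in both directions, \<open>z\<close> being again a multiple of a power of \<open>k * z powr (1 / q)\<close>.\<close>

lemma moment_weight_excess_growth:
  assumes p: "0 < p" and r: "0 < r" and q: "0 < q" and k: "0 < k"
  shows "\<exists>C>0. \<forall>z\<ge>0. excess_growth r (1 / (p * q)) (k * z powr (1 / q)) \<le> C * moment_weight p r q z \<and>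
     moment_weight p r q z \<le> C * excess_growth r (1 / (p * q)) (k * z powr (1 / q))"
proof -
  let ?\<beta> = "1 / (p * q)" and ?v = "\<lambda>z. k * z powr (1 / q)"
  have cmp: "r < ?\<beta> \<longleftrightarrow> q < 1 / (p * r)" "r = ?\<beta> \<longleftrightarrow> q = 1 / (p * r)"
    using p r q by (auto simp: field_simps)
  have e: "r / ?\<beta> = p * r * q" by simp
  have powr_eq: "?v z powr (r / ?\<beta>) = k powr (p * r * q) * z powr (p * r)" if "0 \<le> z" for z
    using that k q unfolding e by (simp add: powr_mult powr_powr)
  have two_sided: ?thesis
    if "0 < A" "0 < B" "\<And>z. 0 \<le> z \<Longrightarrow> excess_growth r ?\<beta> (?v z) \<le> A * moment_weight p r q z"
      "\<And>z. 0 \<le> z \<Longrightarrow> moment_weight p r q z \<le> B * excess_growth r ?\<beta> (?v z)" for A B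
  proof (intro exI[of _ "max A B"] conjI allI impI)
    fix z :: real assume z: "0 \<le> z"
    have "0 \<le> moment_weight p r q z" using log_plus_ge_1[of z] by (auto simp: moment_weight_def)
    then have "A * moment_weight p r q z \<le> max A B * moment_weight p r q z" by (intro mult_right_mono) auto
    then show "excess_growth r ?\<beta> (?v z) \<le> max A B * moment_weight p r q z" using that(3)[OF z] by linarith
    have "0 \<le> excess_growth r ?\<beta> (?v z)" using k by (intro excess_growth_nonneg) auto
    then have "B * excess_growth r ?\<beta> (?v z) \<le> max A B * excess_growth r ?\<beta> (?v z)" by (intro mult_right_mono) auto
    then show "moment_weight p r q z \<le> max A B * excess_growth r ?\<beta> (?v z)" using that(4)[OF z] by linarith
  qed (use that in auto)
  consider "r < ?\<beta>" | "r = ?\<beta>" | "?\<beta> < r" by linarith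
  then show ?thesis
  proof cases
    case 1
    then show ?thesis
      by (intro two_sided[of k "1 / k"]) (use k cmp in \<open>auto simp: excess_growth_def moment_weight_def\<close>)
  next
    case 2
    have pq: "p * r = 1 / q" using 2 p q by (simp add: field_simps)
    let ?C = "1 + \<bar>ln k\<bar> + 1 / q" and ?D = "1 + \<bar>ln (k powr (- q))\<bar> + q"
    have mw: "moment_weight p r q z = z powr (1 / q) * log_plus z" for z
      using cmp 2 pq by (simp add: moment_weight_def)
    have eg: "excess_growth r ?\<beta> (?v z) = ?v z * log_plus (?v z)" for z
      using 2 by (simp add: excess_growth_def)
    show ?thesis
    proof (rule two_sided)
      fix z :: real assume z: "0 \<le> z"
      have "log_plus (?v z) \<le> ?C * log_plus z" by (rule log_plus_scale_le) (use k q z in auto)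
      then have "?v z * log_plus (?v z) \<le> ?v z * (?C * log_plus z)" using k by (intro mult_left_mono) auto
      then show "excess_growth r ?\<beta> (?v z) \<le> (k * ?C) * moment_weight p r q z"
        unfolding eg mw by (simp add: mult_ac)
      have inv: "z = k powr (- q) * ?v z powr q"
        using k q z by (simp add: powr_mult powr_powr powr_minus)
      have "log_plus (k powr (- q) * ?v z powr q) \<le> ?D * log_plus (?v z)"
        by (rule log_plus_scale_le) (use k q z in auto)
      then have "log_plus z \<le> ?D * log_plus (?v z)" using inv by simp
      then have "z powr (1 / q) * log_plus z \<le> z powr (1 / q) * (?D * log_plus (?v z))"
        by (intro mult_left_mono) auto
      then show "moment_weight p r q z \<le> (?D / k) * excess_growth r ?\<beta> (?v z)"
        unfolding eg mw using k by (simp add: mult_ac)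
    qed (use k q in \<open>auto intro!: divide_pos_pos mult_pos_pos add_pos_pos add_nonneg_pos\<close>)
  next
    case 3
    have mw: "moment_weight p r q z = z powr (p * r)" for z
      using cmp 3 by (auto simp: moment_weight_def)
    have eg: "excess_growth r ?\<beta> (?v z) = k powr (p * r * q) * z powr (p * r)" if "0 \<le> z" for z
    proof -
      have "\<not> r < ?\<beta>" "r \<noteq> ?\<beta>" using 3 by auto
      then show ?thesis unfolding powr_eq[OF that, symmetric] excess_growth_def by (simp only: if_False)
    qed
    show ?thesis
      by (rule two_sided[of "k powr (p * r * q)" "1 / k powr (p * r * q)"])
         (use k in \<open>auto simp: mw eg\<close>)
  qed
qed

lemma measurable_excess_series[measurable]: "excess_series r \<beta> \<in> borel_measurable borel"
  unfolding excess_series_def series_from_1_def by measurable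

lemma measurable_log_plus[measurable]: "log_plus \<in> borel_measurable borel"
  unfolding log_plus_def[abs_def] by measurable

lemma measurable_moment_weight[measurable]: "moment_weight p r q \<in> borel_measurable borel"
proof -
  consider "q < 1 / (p * r)" | "q = 1 / (p * r)" | "q > 1 / (p * r)" by linarith
  then show ?thesis by cases (simp_all add: moment_weight_def[abs_def])
qed

lemma nn_integral_finite_mono:
  assumes "\<And>\<omega>. \<omega> \<in> space M \<Longrightarrow> f \<omega> \<le> ennreal C * g \<omega>" "g \<in> borel_measurable M"
    and "(\<integral>\<^sup>+ \<omega>. g \<omega> \<partial>M) < \<infinity>"
  shows "(\<integral>\<^sup>+ \<omega>. f \<omega> \<partial>M) < \<infinity>"
proof -
  have "(\<integral>\<^sup>+ \<omega>. f \<omega> \<partial>M) \<le> (\<integral>\<^sup>+ \<omega>. ennreal C * g \<omega> \<partial>M)" by (intro nn_integral_mono assms)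
  also have "\<dots> = ennreal C * (\<integral>\<^sup>+ \<omega>. g \<omega> \<partial>M)" by (rule nn_integral_cmult) fact
  also have "\<dots> < \<infinity>" using assms(3) by (simp add: ennreal_mult_less_top)
  finally show ?thesis .
qed

context prob_space
begin

lemma excess_series_moment_iff:
  assumes [measurable]: "Z \<in> borel_measurable M"
    and p: "0 < p" and r: "0 < r" and q: "0 < q" and k: "0 < k"
  shows "(\<integral>\<^sup>+ \<omega>. excess_series r (1 / (p * q)) (k * \<bar>Z \<omega>\<bar> powr (1 / q)) \<partial>M) < \<infinity> \<longleftrightarrow>
    (\<integral>\<^sup>+ \<omega>. ennreal (moment_weight p r q \<bar>Z \<omega>\<bar>) \<partial>M) < \<infinity>"
proof -
  let ?\<beta> = "1 / (p * q)" and ?v = "\<lambda>\<omega>. k * \<bar>Z \<omega>\<bar> powr (1 / q)"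
  let ?g = "\<lambda>\<omega>. excess_growth r ?\<beta> (?v \<omega>)" and ?w = "\<lambda>\<omega>. moment_weight p r q \<bar>Z \<omega>\<bar>"
  have \<beta>: "0 < ?\<beta>" using p q by simp
  have v: "0 \<le> ?v \<omega>" for \<omega> using k by simp
  obtain C where C: "C > 0" "\<And>z. z \<ge> 0 \<Longrightarrow> excess_growth r ?\<beta> (k * z powr (1 / q)) \<le> C * moment_weight p r q z"
      "\<And>z. z \<ge> 0 \<Longrightarrow> moment_weight p r q z \<le> C * excess_growth r ?\<beta> (k * z powr (1 / q))"
    using moment_weight_excess_growth[OF p r q k] by blast
  obtain A where A: "A \<ge> 0" "\<And>v. v \<ge> 0 \<Longrightarrow> excess_series r ?\<beta> v \<le> ennreal (A * excess_growth r ?\<beta> v)"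
    using excess_series_le[OF \<beta>, of r] by blast
  obtain B where B: "B \<ge> 0" "\<And>v. v \<ge> 0 \<Longrightarrow> ennreal (excess_growth r ?\<beta> v) \<le> ennreal B * (1 + excess_series r ?\<beta> v)"
    using excess_growth_le[OF \<beta>, of r] by blast
  show ?thesis
  proof
    assume fin: "(\<integral>\<^sup>+ \<omega>. ennreal (?w \<omega>) \<partial>M) < \<infinity>"
    show "(\<integral>\<^sup>+ \<omega>. excess_series r ?\<beta> (?v \<omega>) \<partial>M) < \<infinity>"
    proof (rule nn_integral_finite_mono[OF _ _ fin, of _ "A * C"])
      fix \<omega>
      have "excess_series r ?\<beta> (?v \<omega>) \<le> ennreal (A * ?g \<omega>)" by (rule A(2)) (rule v)
      also have "\<dots> \<le> ennreal (A * (C * ?w \<omega>))" by (intro ennreal_leI mult_left_mono A(1) C(2)) simp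
      also have "\<dots> = ennreal (A * C) * ennreal (?w \<omega>)" using A(1) C(1) by (simp add: ennreal_mult' mult_ac flip: mult.assoc)
      finally show "excess_series r ?\<beta> (?v \<omega>) \<le> ennreal (A * C) * ennreal (?w \<omega>)" .
    qed measurable
  next
    assume fin: "(\<integral>\<^sup>+ \<omega>. excess_series r ?\<beta> (?v \<omega>) \<partial>M) < \<infinity>"
    have "(\<integral>\<^sup>+ \<omega>. 1 + excess_series r ?\<beta> (?v \<omega>) \<partial>M) = 1 + (\<integral>\<^sup>+ \<omega>. excess_series r ?\<beta> (?v \<omega>) \<partial>M)"
      by (subst nn_integral_add) (auto simp: emeasure_space_1)
    then have fin': "(\<integral>\<^sup>+ \<omega>. 1 + excess_series r ?\<beta> (?v \<omega>) \<partial>M) < \<infinity>" using fin by simp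
    show "(\<integral>\<^sup>+ \<omega>. ennreal (?w \<omega>) \<partial>M) < \<infinity>"
    proof (rule nn_integral_finite_mono[OF _ _ fin', of _ "C * B"])
      fix \<omega>
      have "ennreal (?w \<omega>) \<le> ennreal (C * ?g \<omega>)" by (intro ennreal_leI C(3)) simp
      also have "\<dots> = ennreal C * ennreal (?g \<omega>)" using C(1) by (simp add: ennreal_mult')
      also have "\<dots> \<le> ennreal C * (ennreal B * (1 + excess_series r ?\<beta> (?v \<omega>)))" by (intro mult_left_mono B(2) v) simp
      also have "\<dots> = ennreal (C * B) * (1 + excess_series r ?\<beta> (?v \<omega>))"
        using C(1) by (simp add: ennreal_mult' mult.assoc)
      finally show "ennreal (?w \<omega>) \<le> ennreal (C * B) * (1 + excess_series r ?\<beta> (?v \<omega>))" .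
    qed measurable
  qed
qed

text \<open>Tonelli's theorem, applied to the region \<open>\<epsilon> \<le> x < W \<omega> / a\<close>.\<close>

lemma nn_integral_excess:
  assumes [measurable]: "W \<in> borel_measurable M" and a: "0 < a"
  shows "(\<integral>\<^sup>+ \<omega>. ennreal (max 0 (W \<omega> - \<epsilon> * a)) \<partial>M) =
    ennreal a * (\<integral>\<^sup>+ x\<in>{\<epsilon>..}. ennreal (prob {\<omega> \<in> space M. W \<omega> > x * a}) \<partial>lborel)"
proof -
  interpret L: pair_sigma_finite M "lborel :: real measure" by unfold_locales
  let ?h = "\<lambda>\<omega> x. indicator {p. \<epsilon> \<le> snd p \<and> snd p * a < W (fst p)} (\<omega>, x) :: ennreal"
  have "(\<integral>\<^sup>+ \<omega>. ennreal (max 0 (W \<omega> - \<epsilon> * a)) \<partial>M) = (\<integral>\<^sup>+ \<omega>. ennreal a * (\<integral>\<^sup>+ x. ?h \<omega> x \<partial>lborel) \<partial>M)"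
  proof (rule nn_integral_cong)
    fix \<omega>
    have "(\<integral>\<^sup>+ x. ?h \<omega> x \<partial>lborel) = (\<integral>\<^sup>+ x. indicator {\<epsilon>..<W \<omega> / a} x \<partial>lborel)"
      using a by (intro nn_integral_cong) (auto simp: indicator_def field_simps)
    also have "\<dots> = ennreal (max 0 (W \<omega> / a - \<epsilon>))"
      by (cases "\<epsilon> \<le> W \<omega> / a") (auto simp: max_def)
    also have "ennreal a * \<dots> = ennreal (a * max 0 (W \<omega> / a - \<epsilon>))" using a by (simp add: ennreal_mult)
    also have "a * max 0 (W \<omega> / a - \<epsilon>) = max 0 (W \<omega> - \<epsilon> * a)" using a by (simp add: max_mult_distrib_left algebra_simps)
    finally show "ennreal (max 0 (W \<omega> - \<epsilon> * a)) = ennreal a * (\<integral>\<^sup>+ x. ?h \<omega> x \<partial>lborel)"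
      by (simp add: mult.commute)
  qed
  also have "\<dots> = ennreal a * (\<integral>\<^sup>+ \<omega>. \<integral>\<^sup>+ x. ?h \<omega> x \<partial>lborel \<partial>M)" by (rule nn_integral_cmult) measurable
  also have "(\<integral>\<^sup>+ \<omega>. \<integral>\<^sup>+ x. ?h \<omega> x \<partial>lborel \<partial>M) = (\<integral>\<^sup>+ x. \<integral>\<^sup>+ \<omega>. ?h \<omega> x \<partial>M \<partial>lborel)"
    by (rule L.Fubini'[symmetric]) measurable
  also have "\<dots> = (\<integral>\<^sup>+ x\<in>{\<epsilon>..}. ennreal (prob {\<omega> \<in> space M. W \<omega> > x * a}) \<partial>lborel)"
  proof (rule nn_integral_cong)
    fix x
    have "(\<integral>\<^sup>+ \<omega>. ?h \<omega> x \<partial>M) = (\<integral>\<^sup>+ \<omega>. indicator {\<epsilon>..} x * indicator {\<omega> \<in> space M. W \<omega> > x * a} \<omega> \<partial>M)"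
      by (intro nn_integral_cong) (auto simp: indicator_def)
    also have "\<dots> = indicator {\<epsilon>..} x * emeasure M {\<omega> \<in> space M. W \<omega> > x * a}"
      by (subst nn_integral_cmult) auto
    finally show "(\<integral>\<^sup>+ \<omega>. ?h \<omega> x \<partial>M) =
      ennreal (prob {\<omega> \<in> space M. W \<omega> > x * a}) * indicator {\<epsilon>..} x"
      by (simp add: emeasure_eq_measure mult.commute)
  qed
  finally show ?thesis .
qed

lemma powr_greater_iff:
  fixes x q n w p :: real
  assumes "0 < x" "0 < q" "0 < n" "0 \<le> w"
  shows "w powr (1 / q) > x * n powr (1 / (p * q)) \<longleftrightarrow> w > x powr q * n powr (1 / p)"
proof -
  have eq: "x * n powr (1 / (p * q)) = (x powr q * n powr (1 / p)) powr (1 / q)"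
    using assms by (simp add: powr_mult powr_powr)
  let ?y = "x powr q * n powr (1 / p)"
  have "?y powr (1 / q) < w powr (1 / q)" if "?y < w" using that assms by (intro powr_less_mono2) auto
  moreover have "w powr (1 / q) \<le> ?y powr (1 / q)" if "w \<le> ?y" using that assms by (intro powr_mono2) auto
  ultimately show ?thesis unfolding eq by (meson not_le)
qed

lemma nn_integral_tail:
  assumes W[measurable]: "W \<in> borel_measurable M" and W0: "\<And>\<omega>. \<omega> \<in> space M \<Longrightarrow> 0 \<le> W \<omega>"
    and \<epsilon>: "0 < \<epsilon>" and q: "0 < q" and n: "0 < n"
  shows "(\<integral>\<^sup>+ \<omega>. ennreal (max 0 (W \<omega> powr (1 / q) - \<epsilon> * n powr (1 / (p * q)))) \<partial>M) =
    ennreal (n powr (1 / (p * q))) *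
     (\<integral>\<^sup>+ x\<in>{\<epsilon>..}. ennreal (prob {\<omega> \<in> space M. W \<omega> > x powr q * n powr (1 / p)}) \<partial>lborel)"
proof -
  have "(\<integral>\<^sup>+ \<omega>. ennreal (max 0 (W \<omega> powr (1 / q) - \<epsilon> * n powr (1 / (p * q)))) \<partial>M) =
    ennreal (n powr (1 / (p * q))) *
     (\<integral>\<^sup>+ x\<in>{\<epsilon>..}. ennreal (prob {\<omega> \<in> space M. W \<omega> powr (1 / q) > x * n powr (1 / (p * q))}) \<partial>lborel)"
    by (rule nn_integral_excess) (use n in auto)
  also have "(\<integral>\<^sup>+ x\<in>{\<epsilon>..}. ennreal (prob {\<omega> \<in> space M. W \<omega> powr (1 / q) > x * n powr (1 / (p * q))}) \<partial>lborel) =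
     (\<integral>\<^sup>+ x\<in>{\<epsilon>..}. ennreal (prob {\<omega> \<in> space M. W \<omega> > x powr q * n powr (1 / p)}) \<partial>lborel)"
  proof (rule nn_integral_cong)
    fix x :: real
    show "ennreal (prob {\<omega> \<in> space M. W \<omega> powr (1 / q) > x * n powr (1 / (p * q))}) * indicator {\<epsilon>..} x =
      ennreal (prob {\<omega> \<in> space M. W \<omega> > x powr q * n powr (1 / p)}) * indicator {\<epsilon>..} x"
    proof (cases "x \<in> {\<epsilon>..}")
      case True
      then have "{\<omega> \<in> space M. W \<omega> powr (1 / q) > x * n powr (1 / (p * q))} =
        {\<omega> \<in> space M. W \<omega> > x powr q * n powr (1 / p)}"
        using \<epsilon> by (intro Collect_cong conj_cong refl powr_greater_iff q n W0) auto
      then show ?thesis by simp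
    qed simp
  qed
  finally show ?thesis .
qed

text \<open>The scale \<open>c\<close> is arbitrary because the two bounds for the maximum come with different ones:
\<open>c = 1 / K\<close> from above and \<open>c = 2\<close> from below.\<close>

lemma tail_integral_moment_iff:
  assumes [measurable]: "Z \<in> borel_measurable M"
    and p: "0 < p" and r: "0 < r" and q: "0 < q" and c: "0 < c" and \<epsilon>: "0 < \<epsilon>"
  shows "series_from_1 (\<lambda>n. ennreal (real n powr (r - 1)) *
      (\<integral>\<^sup>+ x\<in>{\<epsilon>..}. ennreal (prob {\<omega> \<in> space M. \<bar>Z \<omega>\<bar> > c * (x powr q * real n powr (1 / p))}) \<partial>lborel)) < \<infinity> \<longleftrightarrow>
    (\<integral>\<^sup>+ \<omega>. ennreal (moment_weight p r q \<bar>Z \<omega>\<bar>) \<partial>M) < \<infinity>"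
proof -
  let ?\<beta> = "1 / (p * q)"
  define k where "k = (1 / c) powr (1 / q) / \<epsilon>"
  have k: "k > 0" using c \<epsilon> by (simp add: k_def)
  let ?T = "\<lambda>n. ennreal (n powr (r - 1)) *
      (\<integral>\<^sup>+ x\<in>{\<epsilon>..}. ennreal (prob {\<omega> \<in> space M. \<bar>Z \<omega>\<bar> > c * (x powr q * n powr (1 / p))}) \<partial>lborel)"
  let ?t = "\<lambda>n \<omega>. ennreal (n powr (r - 1 - ?\<beta>) * max 0 (k * \<bar>Z \<omega>\<bar> powr (1 / q) - n powr ?\<beta>))"
  have T: "?T n = ennreal \<epsilon> * (\<integral>\<^sup>+ \<omega>. ?t n \<omega> \<partial>M)" if n: "0 < n" for n :: real
  proof -
    let ?J = "\<integral>\<^sup>+ x\<in>{\<epsilon>..}. ennreal (prob {\<omega> \<in> space M. \<bar>Z \<omega>\<bar> > c * (x powr q * n powr (1 / p))}) \<partial>lborel"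
    have Jeq: "?J = (\<integral>\<^sup>+ x\<in>{\<epsilon>..}. ennreal (prob {\<omega> \<in> space M. \<bar>Z \<omega>\<bar> / c > x powr q * n powr (1 / p)}) \<partial>lborel)"
      using c by (simp add: pos_less_divide_eq mult.commute)
    have "ennreal \<epsilon> * (\<integral>\<^sup>+ \<omega>. ?t n \<omega> \<partial>M) = (\<integral>\<^sup>+ \<omega>. ennreal \<epsilon> * ?t n \<omega> \<partial>M)"
      by (rule nn_integral_cmult[symmetric]) measurable
    also have "\<dots> = (\<integral>\<^sup>+ \<omega>. ennreal (n powr (r - 1 - ?\<beta>)) *
        ennreal (max 0 ((\<bar>Z \<omega>\<bar> / c) powr (1 / q) - \<epsilon> * n powr ?\<beta>)) \<partial>M)"
    proof (rule nn_integral_cong)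
      fix \<omega>
      have "\<epsilon> * max 0 (k * \<bar>Z \<omega>\<bar> powr (1 / q) - n powr ?\<beta>) =
        max 0 ((\<bar>Z \<omega>\<bar> / c) powr (1 / q) - \<epsilon> * n powr ?\<beta>)"
        using \<epsilon> c by (simp add: max_mult_distrib_left right_diff_distrib k_def powr_divide)
      then have "\<epsilon> * (n powr (r - 1 - ?\<beta>) * max 0 (k * \<bar>Z \<omega>\<bar> powr (1 / q) - n powr ?\<beta>)) =
        n powr (r - 1 - ?\<beta>) * max 0 ((\<bar>Z \<omega>\<bar> / c) powr (1 / q) - \<epsilon> * n powr ?\<beta>)"
        by (metis mult.left_commute)
      then show "ennreal \<epsilon> * ?t n \<omega> = ennreal (n powr (r - 1 - ?\<beta>)) *
        ennreal (max 0 ((\<bar>Z \<omega>\<bar> / c) powr (1 / q) - \<epsilon> * n powr ?\<beta>))"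
        using \<epsilon> by (metis ennreal_mult' less_imp_le powr_ge_zero)
    qed
    also have "\<dots> = ennreal (n powr (r - 1 - ?\<beta>)) *
        (\<integral>\<^sup>+ \<omega>. ennreal (max 0 ((\<bar>Z \<omega>\<bar> / c) powr (1 / q) - \<epsilon> * n powr ?\<beta>)) \<partial>M)"
      by (rule nn_integral_cmult) measurable
    also have "(\<integral>\<^sup>+ \<omega>. ennreal (max 0 ((\<bar>Z \<omega>\<bar> / c) powr (1 / q) - \<epsilon> * n powr ?\<beta>)) \<partial>M) =
        ennreal (n powr ?\<beta>) * ?J"
      unfolding Jeq by (rule nn_integral_tail) (use \<epsilon> q n c in auto)
    also have "ennreal (n powr (r - 1 - ?\<beta>)) * (ennreal (n powr ?\<beta>) * ?J) = ?T n"
    proof -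
      have "n powr (r - 1 - ?\<beta>) * n powr ?\<beta> = n powr (r - 1)" by (simp add: powr_add[symmetric])
      then have "ennreal (n powr (r - 1 - ?\<beta>)) * ennreal (n powr ?\<beta>) = ennreal (n powr (r - 1))"
        by (simp add: ennreal_mult'[symmetric])
      then show ?thesis by (simp add: mult.assoc[symmetric])
    qed
    finally show ?thesis by simp
  qed
  have "series_from_1 (\<lambda>n. ?T (real n)) = (\<Sum>n. ennreal \<epsilon> * (\<integral>\<^sup>+ \<omega>. ?t (real (Suc n)) \<omega> \<partial>M))"
    unfolding series_from_1_def by (intro suminf_cong T) simp
  also have "\<dots> = ennreal \<epsilon> * (\<Sum>n. \<integral>\<^sup>+ \<omega>. ?t (real (Suc n)) \<omega> \<partial>M)" by simp
  also have "(\<Sum>n. \<integral>\<^sup>+ \<omega>. ?t (real (Suc n)) \<omega> \<partial>M) = (\<integral>\<^sup>+ \<omega>. excess_series r ?\<beta> (k * \<bar>Z \<omega>\<bar> powr (1 / q)) \<partial>M)"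
    unfolding excess_series_def series_from_1_def by (rule nn_integral_suminf[symmetric]) measurable
  finally have "series_from_1 (\<lambda>n. ?T (real n)) =
    ennreal \<epsilon> * (\<integral>\<^sup>+ \<omega>. excess_series r ?\<beta> (k * \<bar>Z \<omega>\<bar> powr (1 / q)) \<partial>M)" .
  then show ?thesis
    using excess_series_moment_iff[OF assms(1) p r q k] \<epsilon>
    by (auto simp: ennreal_mult_less_top ennreal_mult_eq_top_iff less_top)
qed

end

section \<open>From moments to the integrated tail series\<close>

lemma series_from_1_mono: "(\<And>n. n \<ge> 1 \<Longrightarrow> a n \<le> b n) \<Longrightarrow> series_from_1 a \<le> series_from_1 b"
  unfolding series_from_1_def by (intro suminf_le) auto

lemma series_from_1_cong: "(\<And>n. n \<ge> 1 \<Longrightarrow> a n = b n) \<Longrightarrow> series_from_1 a = series_from_1 b"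
  unfolding series_from_1_def by (intro suminf_cong) auto

lemma series_from_1_add: "series_from_1 (\<lambda>n. a n + b n) = series_from_1 a + series_from_1 b"
  unfolding series_from_1_def by (rule suminf_add[symmetric]) auto

lemma series_from_1_multc: "series_from_1 (\<lambda>n. a n * c) = series_from_1 a * c"
  unfolding series_from_1_def by simp

lemma series_from_1_cmult: "series_from_1 (\<lambda>n. c * a n) = c * series_from_1 a"
  unfolding series_from_1_def by simp

lemma nn_integral_series_from_1:
  assumes "\<And>n. n \<ge> 1 \<Longrightarrow> (\<lambda>x. a n x) \<in> borel_measurable M"
  shows "(\<integral>\<^sup>+ x. series_from_1 (\<lambda>n. a n x) \<partial>M) = series_from_1 (\<lambda>n. \<integral>\<^sup>+ x. a n x \<partial>M)"
  unfolding series_from_1_def by (rule nn_integral_suminf) (use assms in auto)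

lemma nn_integral_powr_tail_finite:
  assumes "1 < t" "0 < \<epsilon>"
  shows "(\<integral>\<^sup>+ x\<in>{\<epsilon>..}. ennreal (x powr (- t)) \<partial>lborel) < \<infinity>"
proof -
  have "(\<integral>\<^sup>+ x\<in>{\<epsilon>..}. ennreal (x powr (- t)) \<partial>lborel) = ennreal (0 - (- (\<epsilon> powr (1 - t) / (t - 1))))"
  proof (rule nn_integral_FTC_atLeast)
    fix x assume "\<epsilon> \<le> x"
    then have "0 < x" using assms by simp
    from DERIV_minus[OF DERIV_cdivide[OF has_real_derivative_powr[OF this, of "1 - t"], of "t - 1"]]
    have "((\<lambda>x. - (x powr (1 - t) / (t - 1))) has_real_derivative - ((1 - t) * x powr (1 - t - 1) / (t - 1))) (at x)" .
    also have "- ((1 - t) * x powr (1 - t - 1) / (t - 1)) = x powr (- t)" using assms by (simp add: field_simps)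
    finally show "((\<lambda>x. - (x powr (1 - t) / (t - 1))) has_real_derivative x powr (- t)) (at x)" .
  next
    have "((\<lambda>x::real. x powr (1 - t)) \<longlongrightarrow> 0) at_top"
      by (rule tendsto_neg_powr[OF _ filterlim_ident]) (use assms in auto)
    then have "((\<lambda>x::real. - (x powr (1 - t) / (t - 1))) \<longlongrightarrow> - (0 / (t - 1))) at_top"
      by (intro tendsto_intros) (use assms in auto)
    then show "((\<lambda>x::real. - (x powr (1 - t) / (t - 1))) \<longlongrightarrow> 0) at_top" by simp
  qed auto
  then show ?thesis by simp
qed

lemma (in prob_space) measurable_prob_greater:
  assumes [measurable]: "W \<in> borel_measurable M" "g \<in> borel_measurable N"
  shows "(\<lambda>x. ennreal (prob {\<omega> \<in> space M. W \<omega> > (g x :: real)})) \<in> borel_measurable N"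
proof -
  have "mono (\<lambda>y. - prob {\<omega> \<in> space M. W \<omega> > y})"
    by (intro monoI le_imp_neg_le finite_measure_mono) auto
  then have "(\<lambda>y. - prob {\<omega> \<in> space M. W \<omega> > y}) \<in> borel_measurable borel" by (rule borel_measurable_mono)
  from measurable_compose[OF assms(2) this] have "(\<lambda>x. - prob {\<omega> \<in> space M. W \<omega> > g x}) \<in> borel_measurable N" .
  then have "(\<lambda>x. - (- prob {\<omega> \<in> space M. W \<omega> > g x})) \<in> borel_measurable N" by (rule borel_measurable_uminus)
  then show ?thesis by simp
qed

context na_sequence
begin

lemma measurable_max_partial_sum: "n \<ge> 1 \<Longrightarrow> max_partial_sum X n \<in> borel_measurable M"
  unfolding max_partial_sum_def[abs_def] by (intro borel_measurable_Max) auto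

lemma max_partial_sum_nonneg: "n \<ge> 1 \<Longrightarrow> 0 \<le> max_partial_sum X n \<omega>"
  unfolding max_partial_sum_def by (subst Max_ge_iff) auto

abbreviation max_tail :: "real \<Rightarrow> nat \<Rightarrow> real \<Rightarrow> real" where
  "max_tail p n x \<equiv> prob {\<omega> \<in> space M. max_partial_sum X n \<omega> > x * real n powr (1 / p)}"

lemma nn_integral_tail_series:
  "(\<integral>\<^sup>+ x\<in>{\<epsilon>..}. tail_series M X p r (x powr q) \<partial>lborel) =
    series_from_1 (\<lambda>n. ennreal (real n powr (r - 2)) *
      (\<integral>\<^sup>+ x\<in>{\<epsilon>..}. ennreal (max_tail p n (x powr q)) \<partial>lborel))"
proof -
  have meas: "(\<lambda>x. ennreal (max_tail p n (x powr q)) * indicator {\<epsilon>..} x) \<in> borel_measurable lborel" if "n \<ge> 1" for n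
    by (intro borel_measurable_times_ennreal borel_measurable_indicator
          measurable_prob_greater[OF measurable_max_partial_sum[OF that]]) measurable
  have "(\<integral>\<^sup>+ x\<in>{\<epsilon>..}. tail_series M X p r (x powr q) \<partial>lborel) =
    (\<integral>\<^sup>+ x. series_from_1 (\<lambda>n. ennreal (real n powr (r - 2)) *
      (ennreal (max_tail p n (x powr q)) * indicator {\<epsilon>..} x)) \<partial>lborel)"
    unfolding tail_series_def by (simp add: ennreal_mult' mult.assoc flip: series_from_1_multc)
  also have "\<dots> = series_from_1 (\<lambda>n. \<integral>\<^sup>+ x. ennreal (real n powr (r - 2)) *
      (ennreal (max_tail p n (x powr q)) * indicator {\<epsilon>..} x) \<partial>lborel)"
    by (intro nn_integral_series_from_1 borel_measurable_times_ennreal borel_measurable_const meas)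
  also have "\<dots> = series_from_1 (\<lambda>n. ennreal (real n powr (r - 2)) *
      (\<integral>\<^sup>+ x\<in>{\<epsilon>..}. ennreal (max_tail p n (x powr q)) \<partial>lborel))"
    by (intro series_from_1_cong nn_integral_cmult meas)
  finally show ?thesis .
qed

text \<open>For each \<open>n\<close>, integrating the tail of the maximum over \<open>x \<ge> \<epsilon>\<close> gives its expected excess; the factor
\<open>n powr (1 / (p * q))\<close> from the substitution explains the exponent of the weights.\<close>

lemma excess_series_eq_nn_integral_tail_series:
  assumes \<epsilon>: "0 < \<epsilon>" and q: "0 < q"
  shows "series_from_1 (\<lambda>n. ennreal (real n powr (r - 2 - 1 / (p * q))) *
        (\<integral>\<^sup>+ \<omega>. ennreal (max 0 (max_partial_sum X n \<omega> powr (1 / q)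
                             - \<epsilon> * real n powr (1 / (p * q)))) \<partial>M)) =
    (\<integral>\<^sup>+ x\<in>{\<epsilon>..}. tail_series M X p r (x powr q) \<partial>lborel)"
  unfolding nn_integral_tail_series
proof (rule series_from_1_cong)
  fix n :: nat assume n: "n \<ge> 1"
  let ?J = "\<integral>\<^sup>+ x\<in>{\<epsilon>..}. ennreal (max_tail p n (x powr q)) \<partial>lborel"
  have 1: "(\<integral>\<^sup>+ \<omega>. ennreal (max 0 (max_partial_sum X n \<omega> powr (1 / q) - \<epsilon> * real n powr (1 / (p * q)))) \<partial>M)
    = ennreal (real n powr (1 / (p * q))) * ?J"
    by (rule nn_integral_tail[OF measurable_max_partial_sum[OF n] max_partial_sum_nonneg[OF n] \<epsilon> q]) (use n in simp)
  have "real n powr (r - 2 - 1 / (p * q)) * real n powr (1 / (p * q)) = real n powr (r - 2)"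
    by (simp add: powr_add[symmetric])
  then have 2: "ennreal (real n powr (r - 2 - 1 / (p * q))) * ennreal (real n powr (1 / (p * q))) = ennreal (real n powr (r - 2))"
    by (simp add: ennreal_mult'[symmetric])
  show "ennreal (real n powr (r - 2 - 1 / (p * q))) *
        (\<integral>\<^sup>+ \<omega>. ennreal (max 0 (max_partial_sum X n \<omega> powr (1 / q) - \<epsilon> * real n powr (1 / (p * q)))) \<partial>M) =
    ennreal (real n powr (r - 2)) * ?J"
    unfolding 1 2[symmetric] by (simp only: mult.assoc)
qed

text \<open>The maximal inequality is applied at \<open>y = x powr q * n powr (1 / p)\<close>.  Its first term gives the series of
single tails, which is the moment condition.  Its second term equals a constant times
\<open>(n + 1) * n powr (- u) * x powr (- t)\<close> with \<open>u = (s / p - 1) * K / 2\<close> and \<open>t = q * s * K / 2\<close>; because \<open>s > p\<close>, both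
exponents become large with \<open>K\<close>, which makes it summable in \<open>n\<close> and integrable in \<open>x\<close>.\<close>

lemma nn_integral_tail_series_finite:
  assumes mom: "centered_moment M s Z" and p: "0 < p" and s: "p < s" and r: "1 < r" and q: "0 < q"
    and fin: "(\<integral>\<^sup>+ \<omega>. ennreal (moment_weight p r q \<bar>Z \<omega>\<bar>) \<partial>M) < \<infinity>" and \<epsilon>: "0 < \<epsilon>"
  shows "(\<integral>\<^sup>+ x\<in>{\<epsilon>..}. tail_series M X p r (x powr q) \<partial>lborel) < \<infinity>"
proof -
  \<comment> \<open>The first summand forces \<open>u \<ge> r + 1\<close>, the second \<open>t > 1\<close>.\<close>
  define K where "K = 2 * (r + 1) / (s / p - 1) + 4 / (q * s)"
  have s0: "0 < s" using p s by simp
  have sp: "0 < s / p - 1" using p s by simp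
  have K: "0 < K" unfolding K_def using r sp q s0 by (intro add_pos_pos divide_pos_pos mult_pos_pos) auto
  define u where "u = (s / p - 1) * (K / 2)"
  define t where "t = q * s * (K / 2)"
  have u: "r + 1 \<le> u"
  proof -
    have "u = (r + 1) + (s / p - 1) * (4 / (q * s)) / 2"
    proof -
      have "w * ((2 * A / w + B) / 2) = A + w * B / 2" if "w \<noteq> 0" for w A B :: real
        using that by (simp add: field_simps)
      from this[OF less_imp_neq[OF sp, symmetric]] show ?thesis unfolding u_def K_def .
    qed
    moreover have "0 \<le> (s / p - 1) * (4 / (q * s)) / 2"
      using less_imp_le[OF sp] q s0 by (intro divide_nonneg_pos mult_nonneg_nonneg) auto
    ultimately show ?thesis by linarith
  qed
  have t: "1 < t"
  proof -
    have "t = q * s * (2 * (r + 1) / (s / p - 1)) / 2 + 2"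
    proof -
      have "w * ((A + 4 / w) / 2) = w * A / 2 + 2" if "w \<noteq> 0" for w A :: real
        using that by (simp add: field_simps)
      from this[of "q * s"] show ?thesis unfolding t_def K_def using mult_pos_pos[OF q s0] by (metis less_irrefl)
    qed
    moreover have "0 \<le> q * s * (2 * (r + 1) / (s / p - 1)) / 2"
      using q s0 r sp by (intro divide_nonneg_pos mult_nonneg_nonneg) auto
    ultimately show ?thesis by linarith
  qed
  define D where "D = 2 * exp (2 * expectation (\<lambda>\<omega>. \<bar>Z \<omega>\<bar> powr s))"
  define H where "H = 2 * D * K powr (s * (K / 2))"
  have H: "0 \<le> H" unfolding H_def D_def by simp
  let ?Q = "\<lambda>n x. prob {\<omega> \<in> space M. \<bar>Z \<omega>\<bar> > 1 / K * (x powr q * real n powr (1 / p))}"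
  have bound: "real n powr (r - 2) * max_tail p n (x powr q)
      \<le> real n powr (r - 1) * ?Q n x + H * real n powr - 2 * x powr (- t)"
    if n: "n \<ge> 1" and x: "0 < x" for n x
  proof -
    let ?y = "x powr q * real n powr (1 / p)"
    have n0: "0 < real n" using n by simp
    have y: "0 < ?y" using x n0 by simp
    have "(?y / K) powr s = x powr (q * s) * real n powr (s / p) / K powr s"
      using y K x n0 by (simp add: powr_divide powr_mult powr_powr)
    then have "real n / (?y / K) powr s = K powr s * x powr (- (q * s)) * real n powr (1 - s / p)"
      using n0 x K by (simp add: powr_diff powr_minus field_simps)
    moreover have "- (q * s) * (K / 2) = - t" "(1 - s / p) * (K / 2) = - u"
      by (simp_all only: t_def u_def minus_mult_left minus_diff_eq)
    ultimately have pow: "(real n / (?y / K) powr s) powr (K / 2) = K powr (s * (K / 2)) * x powr (- t) * real n powr (- u)"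
      by (simp only: powr_mult powr_powr)
    have "max_tail p n (x powr q) \<le> n * ?Q n x + (real n + 1) * D * (K powr (s * (K / 2)) * x powr (- t) * real n powr (- u))"
      using maximal_tail[OF mom y K n] unfolding pow D_def by (simp add: algebra_simps)
    then have "real n powr (r - 2) * max_tail p n (x powr q) \<le>
      real n powr (r - 2) * (n * ?Q n x + (real n + 1) * D * (K powr (s * (K / 2)) * x powr (- t) * real n powr (- u)))"
      by (intro mult_left_mono) auto
    also have "\<dots> = (real n powr (r - 2) * n) * ?Q n x +
       (D * K powr (s * (K / 2)) * x powr (- t)) * ((real n + 1) * (real n powr (r - 2) * real n powr (- u)))"
      by (simp add: algebra_simps)
    also have "real n powr (r - 2) * n = real n powr (r - 1)"
      using n0 powr_add[of "real n" "r - 2" 1] by simp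
    also have "real n powr (r - 1) * ?Q n x +
       (D * K powr (s * (K / 2)) * x powr (- t)) * ((real n + 1) * (real n powr (r - 2) * real n powr (- u))) \<le>
       real n powr (r - 1) * ?Q n x + (D * K powr (s * (K / 2)) * x powr (- t)) * (2 * real n powr - 2)"
    proof (intro add_left_mono mult_left_mono)
      have "(real n + 1) * (real n powr (r - 2) * real n powr (- u)) \<le> (2 * real n powr 1) * real n powr (- 3)"
      proof (intro mult_mono)
        have "real n powr (r - 2 - u) \<le> real n powr (- 3)" using n u by (intro powr_mono) auto
        then show "real n powr (r - 2) * real n powr (- u) \<le> real n powr (- 3)" by (simp add: powr_add[symmetric])
      qed (use n in auto)
      also have "\<dots> = 2 * real n powr - 2"
        by (simp only: mult.assoc powr_add[symmetric]) simp
      finally show "(real n + 1) * (real n powr (r - 2) * real n powr (- u)) \<le> 2 * real n powr - 2" .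
    qed (simp add: D_def)
    also have "(D * K powr (s * (K / 2)) * x powr (- t)) * (2 * real n powr - 2) = H * real n powr - 2 * x powr (- t)"
      by (simp add: H_def mult_ac)
    finally show ?thesis .
  qed
  define a where "a = (\<lambda>n x. ennreal (real n powr (r - 1)) * (ennreal (?Q n x) * indicator {\<epsilon>..} x))"
  define b where "b = (\<lambda>n x. ennreal (H * real n powr - 2) * (ennreal (x powr (- t)) * indicator {\<epsilon>..} x))"
  have Q_meas: "(\<lambda>x. ennreal (?Q n x) * indicator {\<epsilon>..} x) \<in> borel_measurable lborel" for n
    by (intro borel_measurable_times_ennreal borel_measurable_indicator measurable_prob_greater) measurable
  have a_meas: "a n \<in> borel_measurable lborel" for n
    unfolding a_def by (intro borel_measurable_times_ennreal borel_measurable_const Q_meas)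
  have b_meas: "b n \<in> borel_measurable lborel" for n
    unfolding b_def by measurable
  have "(\<integral>\<^sup>+ x\<in>{\<epsilon>..}. tail_series M X p r (x powr q) \<partial>lborel)
    \<le> (\<integral>\<^sup>+ x. series_from_1 (\<lambda>n. a n x + b n x) \<partial>lborel)"
  proof (rule nn_integral_mono)
    fix x :: real
    show "tail_series M X p r (x powr q) * indicator {\<epsilon>..} x \<le> series_from_1 (\<lambda>n. a n x + b n x)"
    proof (cases "\<epsilon> \<le> x")
      case True
      then have x: "0 < x" using \<epsilon> by simp
      have "tail_series M X p r (x powr q) \<le> series_from_1 (\<lambda>n. a n x + b n x)"
        unfolding tail_series_def
      proof (rule series_from_1_mono)
        fix n :: nat assume n: "n \<ge> 1"
        have "ennreal (real n powr (r - 2) * max_tail p n (x powr q))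
          \<le> ennreal (real n powr (r - 1) * ?Q n x + H * real n powr - 2 * x powr (- t))"
          by (intro ennreal_leI bound n x)
        also have "\<dots> = a n x + b n x"
          unfolding a_def b_def using True H by (simp add: ennreal_plus ennreal_mult)
        finally show "ennreal (real n powr (r - 2) * max_tail p n (x powr q)) \<le> a n x + b n x" .
      qed
      then show ?thesis using True by simp
    qed simp
  qed
  also have "\<dots> = series_from_1 (\<lambda>n. \<integral>\<^sup>+ x. a n x + b n x \<partial>lborel)"
    by (rule nn_integral_series_from_1) (intro borel_measurable_add a_meas b_meas)
  also have "\<dots> = series_from_1 (\<lambda>n. (\<integral>\<^sup>+ x. a n x \<partial>lborel) + (\<integral>\<^sup>+ x. b n x \<partial>lborel))"
    by (intro series_from_1_cong nn_integral_add a_meas b_meas)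
  also have "\<dots> = series_from_1 (\<lambda>n. \<integral>\<^sup>+ x. a n x \<partial>lborel) + series_from_1 (\<lambda>n. \<integral>\<^sup>+ x. b n x \<partial>lborel)"
    by (rule series_from_1_add)
  finally have le: "(\<integral>\<^sup>+ x\<in>{\<epsilon>..}. tail_series M X p r (x powr q) \<partial>lborel) \<le>
    series_from_1 (\<lambda>n. \<integral>\<^sup>+ x. a n x \<partial>lborel) + series_from_1 (\<lambda>n. \<integral>\<^sup>+ x. b n x \<partial>lborel)" .
  have "series_from_1 (\<lambda>n. \<integral>\<^sup>+ x. a n x \<partial>lborel) < \<infinity>"
  proof -
    have "(\<integral>\<^sup>+ x. a n x \<partial>lborel) = ennreal (real n powr (r - 1)) * (\<integral>\<^sup>+ x\<in>{\<epsilon>..}. ennreal (?Q n x) \<partial>lborel)" for n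
      unfolding a_def by (intro nn_integral_cmult Q_meas)
    then show ?thesis
      using tail_integral_moment_iff[OF Z p _ q _ \<epsilon>, of r "1 / K"] r K fin by simp
  qed
  moreover have "series_from_1 (\<lambda>n. \<integral>\<^sup>+ x. b n x \<partial>lborel) < \<infinity>"
  proof -
    let ?I = "\<integral>\<^sup>+ x\<in>{\<epsilon>..}. ennreal (x powr (- t)) \<partial>lborel"
    have "(\<integral>\<^sup>+ x. b n x \<partial>lborel) = ennreal (H * real n powr - 2) * ?I" for n
      unfolding b_def by (intro nn_integral_cmult) measurable
    then have "series_from_1 (\<lambda>n. \<integral>\<^sup>+ x. b n x \<partial>lborel) = series_from_1 (\<lambda>n. ennreal (H * real n powr - 2)) * ?I"
      by (simp only: series_from_1_multc)
    moreover have "summable (\<lambda>n. H * real (Suc n) powr - 2)"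
    proof (intro summable_mult)
      have "summable (\<lambda>n. real n powr - 2)" by (simp add: summable_real_powr_iff)
      then show "summable (\<lambda>n. real (Suc n) powr - 2)" by (rule summable_Suc_iff[THEN iffD2])
    qed
    then have "series_from_1 (\<lambda>n. ennreal (H * real n powr - 2)) < \<infinity>"
      unfolding series_from_1_def using ennreal_suminf_neq_top H by (simp add: less_top)
    ultimately show ?thesis using nn_integral_powr_tail_finite[OF t \<epsilon>] by (simp add: ennreal_mult_less_top)
  qed
  ultimately show ?thesis by (intro le_less_trans[OF le]) simp
qed

end

section \<open>From the tail series back to moments\<close>

context na_sequence
begin

lemma tail_series_antimono: "x \<le> y \<Longrightarrow> tail_series M X p r y \<le> tail_series M X p r x"
  unfolding tail_series_def
proof (intro series_from_1_mono ennreal_leI mult_left_mono finite_measure_mono)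
  fix n :: nat assume n: "n \<ge> 1" and xy: "x \<le> y"
  have "x * real n powr (1 / p) \<le> y * real n powr (1 / p)" using xy by (intro mult_right_mono) auto
  then show "{\<omega> \<in> space M. max_partial_sum X n \<omega> > y * real n powr (1 / p)} \<subseteq>
    {\<omega> \<in> space M. max_partial_sum X n \<omega> > x * real n powr (1 / p)}" by auto
  show "{\<omega> \<in> space M. max_partial_sum X n \<omega> > x * real n powr (1 / p)} \<in> sets M"
    using measurable_max_partial_sum[OF n] by measurable
qed auto

lemma tail_series_finite:
  assumes fin: "\<And>\<epsilon>::real. 0 < \<epsilon> \<Longrightarrow> (\<integral>\<^sup>+ x\<in>{\<epsilon>..}. tail_series M X p r (x powr q) \<partial>lborel) < \<infinity>"
    and q: "0 < q" and x: "0 < x"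
  shows "tail_series M X p r x < \<infinity>"
proof -
  define e where "e = x powr (1 / q) / 2"
  have e: "0 < e" using x by (simp add: e_def)
  have "ennreal e * tail_series M X p r x = (\<integral>\<^sup>+ y. tail_series M X p r x * indicator {e..2 * e} y \<partial>lborel)"
    using e by (subst nn_integral_cmult_indicator) (auto simp: mult.commute)
  also have "\<dots> \<le> (\<integral>\<^sup>+ y\<in>{e..}. tail_series M X p r (y powr q) \<partial>lborel)"
  proof (rule nn_integral_mono)
    fix y :: real
    show "tail_series M X p r x * indicator {e..2 * e} y \<le> tail_series M X p r (y powr q) * indicator {e..} y"
    proof (cases "y \<in> {e..2 * e}")
      case True
      then have "y powr q \<le> (2 * e) powr q" using e q by (intro powr_mono2) auto
      also have "\<dots> = x" using x q by (simp add: e_def powr_powr)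
      finally show ?thesis using True tail_series_antimono by simp
    qed simp
  qed
  also have "\<dots> < \<infinity>" by (rule fin[OF e])
  finally show ?thesis using e by (auto simp: ennreal_mult_less_top)
qed

lemma max_partial_sum_mono: "1 \<le> n \<Longrightarrow> n \<le> m \<Longrightarrow> max_partial_sum X n \<omega> \<le> max_partial_sum X m \<omega>"
  unfolding max_partial_sum_def by (intro Max_mono) auto

text \<open>For \<open>r < 2\<close> the weights tend to zero, so single terms of the series say nothing; blocks do, because the
events grow with \<open>n\<close> for a fixed threshold.  All terms with \<open>n < k \<le> 2 * n\<close> are bounded below through the event at \<open>n\<close> with the
threshold belonging to \<open>2 * n\<close>.  As \<open>r > 1\<close>, the weight of each of them is at least \<open>1 / (2 * n)\<close>, so a block of length
\<open>n\<close> carries at least half of that probability.\<close>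

lemma max_tail_tendsto_0:
  assumes fin: "\<And>x. 0 < x \<Longrightarrow> tail_series M X p r x < \<infinity>" and p: "0 < p" and r: "1 < r" and y: "0 < y"
  shows "(\<lambda>n. max_tail p n y) \<longlonglongrightarrow> 0"
proof -
  define x where "x = y / 2 powr (1 / p)"
  have x: "0 < x" using y by (simp add: x_def)
  define g where "g = (\<lambda>k. real (Suc k) powr (r - 2) * max_tail p (Suc k) x)"
  have g0: "0 \<le> g k" for k by (simp add: g_def)
  have "summable g"
    using fin[OF x] unfolding tail_series_def series_from_1_def
    by (intro summable_suminf_not_top g0) (simp add: g_def less_top)
  have key: "max_tail p n y \<le> 2 * sum g {n..<2 * n}" if n: "n \<ge> 1" for n
  proof -
    have "max_tail p n y / (2 * real n) \<le> g k" if k: "k \<in> {n..<2 * n}" for k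
    proof -
      have "x * real (Suc k) powr (1 / p) \<le> x * (2 * real n) powr (1 / p)"
        using k p x by (intro mult_left_mono powr_mono2) auto
      also have "\<dots> = y * real n powr (1 / p)" by (simp add: x_def powr_mult)
      finally have thr: "x * real (Suc k) powr (1 / p) \<le> y * real n powr (1 / p)" .
      have "max_tail p n y \<le> max_tail p (Suc k) x"
      proof (rule finite_measure_mono)
        show "{\<omega> \<in> space M. max_partial_sum X n \<omega> > y * real n powr (1 / p)} \<subseteq>
          {\<omega> \<in> space M. max_partial_sum X (Suc k) \<omega> > x * real (Suc k) powr (1 / p)}"
        proof (intro Collect_mono impI conjI; elim conjE)
          fix \<omega> assume "max_partial_sum X n \<omega> > y * real n powr (1 / p)"
          also have "max_partial_sum X n \<omega> \<le> max_partial_sum X (Suc k) \<omega>"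
            using k n by (intro max_partial_sum_mono) auto
          finally show "max_partial_sum X (Suc k) \<omega> > x * real (Suc k) powr (1 / p)" using thr by linarith
        qed
        show "{\<omega> \<in> space M. max_partial_sum X (Suc k) \<omega> > x * real (Suc k) powr (1 / p)} \<in> sets M"
          using measurable_max_partial_sum[of "Suc k"] by measurable
      qed
      moreover have "1 / (2 * real n) \<le> real (Suc k) powr (r - 2)"
      proof -
        have "1 / (2 * real n) \<le> 1 / real (Suc k)" using k by (intro divide_left_mono) auto
        also have "\<dots> = real (Suc k) powr - 1" by (simp add: powr_minus_divide)
        also have "\<dots> \<le> real (Suc k) powr (r - 2)" using r by (intro powr_mono) auto
        finally show ?thesis .
      qed
      ultimately have "1 / (2 * real n) * max_tail p n y \<le> g k" unfolding g_def by (intro mult_mono) auto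
      then show ?thesis by simp
    qed
    then have "(\<Sum>k\<in>{n..<2 * n}. max_tail p n y / (2 * real n)) \<le> sum g {n..<2 * n}" by (rule sum_mono)
    then show ?thesis using n by (simp add: field_simps)
  qed
  show ?thesis
  proof (rule LIMSEQ_I)
    fix e :: real assume e: "0 < e"
    then have "0 < e / 2" by simp
    then obtain N where N: "\<And>m n. m \<ge> N \<Longrightarrow> norm (sum g {m..<n}) < e / 2"
      using \<open>summable g\<close> unfolding summable_Cauchy by blast
    show "\<exists>N. \<forall>n\<ge>N. norm (max_tail p n y - 0) < e"
    proof (intro exI[of _ "max 1 N"] allI impI)
      fix n assume "max 1 N \<le> n"
      then show "norm (max_tail p n y - 0) < e" using key[of n] N[of n "2 * n"] by auto
    qed
  qed
qed

text \<open>A weak law of large numbers, read off from the integrated series for the parameters \<open>s / p\<close> and \<open>2 / s\<close>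
in place of \<open>r\<close> and \<open>q\<close>, for which the moment condition is the moment of order \<open>s\<close>.\<close>

lemma max_tail_tendsto_0_centered:
  assumes mom: "centered_moment M s Z" and p: "0 < p" and s: "p < s" and y: "0 < y"
  shows "(\<lambda>n. max_tail p n y) \<longlonglongrightarrow> 0"
proof -
  have i: "integrable M (\<lambda>\<omega>. \<bar>Z \<omega>\<bar> powr s)" using mom by (simp add: centered_moment_def)
  have r: "1 < s / p" using p s by simp
  have s0: "0 < s" using p s by simp
  have ps: "p * (s / p) = s" using p by simp
  have w: "moment_weight p (s / p) (2 / s) z = z powr s" for z
    unfolding moment_weight_def ps using s0 by (simp add: field_simps)
  have fin: "(\<integral>\<^sup>+ \<omega>. ennreal (moment_weight p (s / p) (2 / s) \<bar>Z \<omega>\<bar>) \<partial>M) < \<infinity>"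
    unfolding w using i by (subst nn_integral_eq_integral) auto
  show ?thesis
  proof (rule max_tail_tendsto_0[OF _ p r y])
    show "tail_series M X p (s / p) x < \<infinity>" if "0 < x" for x
      by (rule tail_series_finite[OF nn_integral_tail_series_finite[OF mom p s r _ fin] _ that])
         (use s0 in auto)
  qed
qed

text \<open>For \<open>u = n * P(Z > y)\<close> negative association gives \<open>P(\<forall>i. X i \<le> y) \<le> (1 - u / n) ^ n \<le> 1 / (1 + u)\<close>, so the
maximum of the terms exceeds \<open>y\<close> with probability at least \<open>u / (1 + u)\<close>, as in the independent case.\<close>

lemma one_sided_max_term_ge:
  "real n * prob {\<omega> \<in> space M. Z \<omega> > y} \<le>
    (1 + real n * prob {\<omega> \<in> space M. Z \<omega> > y}) * prob {\<omega> \<in> space M. \<exists>i\<in>{1..n}. X i \<omega> > y}"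
proof -
  define P where "P = prob {\<omega> \<in> space M. Z \<omega> > y}"
  have P: "0 \<le> P" "P \<le> 1" unfolding P_def by auto
  have Xm[measurable]: "i \<in> {1..n} \<Longrightarrow> X i \<in> borel_measurable M" for i by auto
  have compl: "prob {\<omega> \<in> space M. Z \<omega> \<le> y} = 1 - P"
    unfolding P_def by (subst prob_compl[symmetric]) (auto intro!: arg_cong[where f=prob])
  have "prob {\<omega> \<in> space M. \<forall>i\<in>{1..n}. X i \<omega> \<le> y} \<le> (\<Prod>i=1..n. prob {\<omega> \<in> space M. X i \<omega> \<le> y})"
    by (rule negatively_associated_prob_all_le[OF na X])
  also have "\<dots> = (\<Prod>i=1..n. 1 - P)"
    unfolding compl[symmetric] by (intro prod.cong refl prob_eq[of _ "\<lambda>x. x \<le> y"]) auto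
  also have "\<dots> = (1 - P) ^ n" by simp
  also have "\<dots> \<le> exp (- P) ^ n" using P exp_ge_add_one_self[of "- P"] by (intro power_mono) auto
  also have "\<dots> = 1 / exp (real n * P)" by (simp add: exp_of_nat_mult exp_minus divide_inverse power_inverse)
  also have "\<dots> \<le> 1 / (1 + real n * P)"
    using P exp_ge_add_one_self[of "real n * P"] by (intro divide_left_mono mult_pos_pos add_pos_nonneg) auto
  finally have all: "prob {\<omega> \<in> space M. \<forall>i\<in>{1..n}. X i \<omega> \<le> y} \<le> 1 / (1 + real n * P)" .
  have "{\<omega> \<in> space M. \<exists>i\<in>{1..n}. X i \<omega> > y} = space M - {\<omega> \<in> space M. \<forall>i\<in>{1..n}. X i \<omega> \<le> y}"
    by (auto simp: not_le)
  moreover have "{\<omega> \<in> space M. \<forall>i\<in>{1..n}. X i \<omega> \<le> y} \<in> sets M" by measurable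
  ultimately have "prob {\<omega> \<in> space M. \<exists>i\<in>{1..n}. X i \<omega> > y} = 1 - prob {\<omega> \<in> space M. \<forall>i\<in>{1..n}. X i \<omega> \<le> y}"
    by (simp only: prob_compl)
  then have "1 - 1 / (1 + real n * P) \<le> prob {\<omega> \<in> space M. \<exists>i\<in>{1..n}. X i \<omega> > y}" using all by simp
  then have "(1 + real n * P) * (1 - 1 / (1 + real n * P)) \<le> (1 + real n * P) * prob {\<omega> \<in> space M. \<exists>i\<in>{1..n}. X i \<omega> > y}"
    using P by (intro mult_left_mono) auto
  moreover have "(1 + real n * P) * (1 - 1 / (1 + real n * P)) = real n * P"
  proof -
    have "1 + real n * P > 0" using P by (simp add: add_pos_nonneg)
    then show ?thesis by (simp add: field_simps)
  qed
  ultimately show ?thesis unfolding P_def by simp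
qed

lemma term_le_max_partial_sum:
  assumes "i \<in> {1..n}"
  shows "\<bar>X i \<omega>\<bar> \<le> 2 * max_partial_sum X n \<omega>"
proof -
  have le: "\<bar>partial_sum X k \<omega>\<bar> \<le> max_partial_sum X n \<omega>" if "k \<le> n" for k
  proof (cases "k = 0")
    case True
    then show ?thesis using max_partial_sum_nonneg[of n \<omega>] assms by (simp add: partial_sum_def)
  next
    case False
    then show ?thesis unfolding max_partial_sum_def using that by (intro Max_ge) auto
  qed
  obtain j where j: "i = Suc j" using assms by (cases i) auto
  have "X i \<omega> = partial_sum X i \<omega> - partial_sum X j \<omega>" by (simp add: partial_sum_def j)
  then show ?thesis using le[of i] le[of j] assms j by auto
qed

lemma mult_tail_le_max_partial_sum:
  assumes n: "n \<ge> 1"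
  shows "real n * prob {\<omega> \<in> space M. \<bar>Z \<omega>\<bar> > 2 * y} \<le>
    2 * (1 + real n * prob {\<omega> \<in> space M. \<bar>Z \<omega>\<bar> > 2 * y}) * prob {\<omega> \<in> space M. max_partial_sum X n \<omega> > y}"
proof -
  interpret neg: na_sequence M "\<lambda>n \<omega>. - X n \<omega>" "\<lambda>\<omega>. - Z \<omega>" by (rule na_sequence_uminus)
  have [measurable]: "max_partial_sum X n \<in> borel_measurable M" by (rule measurable_max_partial_sum[OF n])
  let ?u = "real n * prob {\<omega> \<in> space M. \<bar>Z \<omega>\<bar> > 2 * y}"
  let ?a = "prob {\<omega> \<in> space M. max_partial_sum X n \<omega> > y}"
  have one: "real n * prob {\<omega> \<in> space M. W \<omega> > 2 * y} \<le> (1 + ?u) * ?a"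
    if le: "real n * prob {\<omega> \<in> space M. W \<omega> > 2 * y} \<le>
      (1 + real n * prob {\<omega> \<in> space M. W \<omega> > 2 * y}) * prob {\<omega> \<in> space M. \<exists>i\<in>{1..n}. Y i \<omega> > 2 * y}"
      and [measurable]: "W \<in> borel_measurable M" and W: "\<And>\<omega>. W \<omega> \<le> \<bar>Z \<omega>\<bar>" and Y: "\<And>i \<omega>. Y i \<omega> \<le> \<bar>X i \<omega>\<bar>" for W Y
  proof -
    have "prob {\<omega> \<in> space M. W \<omega> > 2 * y} \<le> prob {\<omega> \<in> space M. \<bar>Z \<omega>\<bar> > 2 * y}"
      using W by (intro finite_measure_mono) (auto intro: less_le_trans)
    moreover have "prob {\<omega> \<in> space M. \<exists>i\<in>{1..n}. Y i \<omega> > 2 * y} \<le> ?a"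
    proof (intro finite_measure_mono Collect_mono impI conjI; (elim conjE bexE)?)
      fix \<omega> i assume "i \<in> {1..n}" "Y i \<omega> > 2 * y"
      then show "max_partial_sum X n \<omega> > y" using term_le_max_partial_sum[of i n \<omega>] Y[of i \<omega>] by linarith
    qed auto
    ultimately have "(1 + real n * prob {\<omega> \<in> space M. W \<omega> > 2 * y}) * prob {\<omega> \<in> space M. \<exists>i\<in>{1..n}. Y i \<omega> > 2 * y} \<le> (1 + ?u) * ?a"
      by (intro mult_mono add_left_mono mult_left_mono) auto
    with le show ?thesis by linarith
  qed
  have "?u \<le> real n * (prob {\<omega> \<in> space M. Z \<omega> > 2 * y} + prob {\<omega> \<in> space M. - Z \<omega> > 2 * y})"
  proof (intro mult_left_mono)
    have "{\<omega> \<in> space M. \<bar>Z \<omega>\<bar> > 2 * y} = {\<omega> \<in> space M. Z \<omega> > 2 * y} \<union> {\<omega> \<in> space M. - Z \<omega> > 2 * y}"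
      unfolding less_abs_iff by blast
    then show "prob {\<omega> \<in> space M. \<bar>Z \<omega>\<bar> > 2 * y} \<le>
      prob {\<omega> \<in> space M. Z \<omega> > 2 * y} + prob {\<omega> \<in> space M. - Z \<omega> > 2 * y}"
      by (simp only:) (rule measure_Un_le; measurable)
  qed simp
  also have "\<dots> \<le> (1 + ?u) * ?a + (1 + ?u) * ?a"
    unfolding distrib_left
    by (intro add_mono one[OF one_sided_max_term_ge] one[OF neg.one_sided_max_term_ge]) auto
  finally show ?thesis by (simp add: algebra_simps)
qed

text \<open>The lower bound for the maximum loses the factor \<open>1 + u\<close> with \<open>u = n * P(\<bar>Z\<bar> > 2 * y)\<close>.  Once the
probability on the right is below \<open>1 / 4\<close> the bound itself forces \<open>u \<le> 1\<close>, so \<open>u\<close> is bounded along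
\<open>y = n powr (1 / p)\<close>, and by monotonicity also at all larger thresholds.\<close>

lemma moment_weight_finite:
  assumes fin: "\<And>\<epsilon>::real. 0 < \<epsilon> \<Longrightarrow> (\<integral>\<^sup>+ x\<in>{\<epsilon>..}. tail_series M X p r (x powr q) \<partial>lborel) < \<infinity>"
    and p: "0 < p" and r: "1 < r" and q: "0 < q"
  shows "(\<integral>\<^sup>+ \<omega>. ennreal (moment_weight p r q \<bar>Z \<omega>\<bar>) \<partial>M) < \<infinity>"
proof -
  let ?P = "\<lambda>y n. prob {\<omega> \<in> space M. \<bar>Z \<omega>\<bar> > 2 * (y * real n powr (1 / p))}"
  have "(\<lambda>n. max_tail p n 1) \<longlonglongrightarrow> 0"
    by (rule max_tail_tendsto_0[OF tail_series_finite[OF fin q] p r]) auto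
  then have "\<forall>\<^sub>F n in sequentially. max_tail p n 1 < 1 / 4" by (rule order_tendstoD) simp
  then obtain N where N: "\<And>n. n \<ge> N \<Longrightarrow> max_tail p n 1 < 1 / 4" by (auto simp: eventually_sequentially)
  define U where "U = max 1 (real N)"
  have U: "0 \<le> U" by (simp add: U_def)
  have bounded: "real n * ?P 1 n \<le> U" if n: "n \<ge> 1" for n
  proof (cases "n \<ge> N")
    case True
    have "real n * ?P 1 n \<le> 2 * (1 + real n * ?P 1 n) * max_tail p n 1"
      by (rule mult_tail_le_max_partial_sum[OF n])
    also have "\<dots> \<le> 2 * (1 + real n * ?P 1 n) * (1 / 4)"
      using N[OF True] by (intro mult_left_mono) auto
    finally show ?thesis by (simp add: U_def)
  next
    case False
    have "real n * ?P 1 n \<le> real n * 1" by (intro mult_left_mono) auto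
    then show ?thesis using False by (simp add: U_def)
  qed
  have bound: "real n powr (r - 1) * ?P (x powr q) n \<le> 2 * (1 + U) * (real n powr (r - 2) * max_tail p n (x powr q))"
    if n: "n \<ge> 1" and x: "1 \<le> x" for n x
  proof -
    have "?P (x powr q) n \<le> ?P 1 n"
    proof (intro finite_measure_mono Collect_mono impI conjI; (elim conjE)?)
      fix \<omega> assume "\<bar>Z \<omega>\<bar> > 2 * (x powr q * real n powr (1 / p))"
      moreover have "1 * real n powr (1 / p) \<le> x powr q * real n powr (1 / p)"
        using x q by (intro mult_right_mono ge_one_powr_ge_zero) auto
      ultimately show "\<bar>Z \<omega>\<bar> > 2 * (1 * real n powr (1 / p))" by linarith
    qed auto
    then have "real n * ?P (x powr q) n \<le> U"
      using bounded[OF n] mult_left_mono[of "?P (x powr q) n" "?P 1 n" "real n"] by simp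
    then have "2 * (1 + real n * ?P (x powr q) n) * max_tail p n (x powr q) \<le> 2 * (1 + U) * max_tail p n (x powr q)"
      by (intro mult_right_mono) auto
    with mult_tail_le_max_partial_sum[OF n, of "x powr q * real n powr (1 / p)"]
    have "real n * ?P (x powr q) n \<le> 2 * (1 + U) * max_tail p n (x powr q)" by linarith
    then have "real n powr (r - 2) * (real n * ?P (x powr q) n) \<le>
      real n powr (r - 2) * (2 * (1 + U) * max_tail p n (x powr q))" by (intro mult_left_mono) auto
    then have "(real n powr (r - 2) * real n) * ?P (x powr q) n \<le>
      2 * (1 + U) * (real n powr (r - 2) * max_tail p n (x powr q))" by (simp only: mult_ac)
    also have "real n powr (r - 2) * real n = real n powr (r - 1)"
      using n powr_add[of "real n" "r - 2" 1] by simp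
    finally show ?thesis .
  qed
  have "series_from_1 (\<lambda>n. ennreal (real n powr (r - 1)) *
      (\<integral>\<^sup>+ x\<in>{1..}. ennreal (?P (x powr q) n) \<partial>lborel)) \<le>
    series_from_1 (\<lambda>n. ennreal (2 * (1 + U)) * (ennreal (real n powr (r - 2)) *
      (\<integral>\<^sup>+ x\<in>{1..}. ennreal (max_tail p n (x powr q)) \<partial>lborel)))"
  proof (rule series_from_1_mono)
    fix n :: nat assume n: "n \<ge> 1"
    let ?c = "ennreal (2 * (1 + U)) * ennreal (real n powr (r - 2))"
    have Pm: "(\<lambda>x. ennreal (?P (x powr q) n) * indicator {1..} x) \<in> borel_measurable lborel"
      by (intro borel_measurable_times_ennreal borel_measurable_indicator measurable_prob_greater) measurable
    have Tm: "(\<lambda>x. ennreal (max_tail p n (x powr q)) * indicator {1..} x) \<in> borel_measurable lborel"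
      by (intro borel_measurable_times_ennreal borel_measurable_indicator
          measurable_prob_greater[OF measurable_max_partial_sum[OF n]]) measurable
    have "ennreal (real n powr (r - 1)) * (\<integral>\<^sup>+ x\<in>{1..}. ennreal (?P (x powr q) n) \<partial>lborel) =
      (\<integral>\<^sup>+ x. ennreal (real n powr (r - 1)) * (ennreal (?P (x powr q) n) * indicator {1..} x) \<partial>lborel)"
      by (rule nn_integral_cmult[symmetric, OF Pm])
    also have "\<dots> \<le> (\<integral>\<^sup>+ x. ?c * (ennreal (max_tail p n (x powr q)) * indicator {1..} x) \<partial>lborel)"
    proof (rule nn_integral_mono)
      fix x :: real
      show "ennreal (real n powr (r - 1)) * (ennreal (?P (x powr q) n) * indicator {1..} x) \<le>
        ?c * (ennreal (max_tail p n (x powr q)) * indicator {1..} x)"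
      proof (cases "1 \<le> x")
        case True
        have "ennreal (real n powr (r - 1) * ?P (x powr q) n) \<le>
          ennreal (2 * (1 + U) * (real n powr (r - 2) * max_tail p n (x powr q)))"
          by (intro ennreal_leI bound n True)
        also have "\<dots> = ?c * ennreal (max_tail p n (x powr q))"
          using U by (simp only: ennreal_mult' ennreal_mult'' mult.assoc measure_nonneg powr_ge_zero)
        finally show ?thesis using True by (simp add: ennreal_mult')
      qed simp
    qed
    also have "\<dots> = ?c * (\<integral>\<^sup>+ x\<in>{1..}. ennreal (max_tail p n (x powr q)) \<partial>lborel)"
      by (rule nn_integral_cmult[OF Tm])
    finally show "ennreal (real n powr (r - 1)) * (\<integral>\<^sup>+ x\<in>{1..}. ennreal (?P (x powr q) n) \<partial>lborel) \<le>
      ennreal (2 * (1 + U)) * (ennreal (real n powr (r - 2)) *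
        (\<integral>\<^sup>+ x\<in>{1..}. ennreal (max_tail p n (x powr q)) \<partial>lborel))"
      by (simp only: mult.assoc)
  qed
  also have "\<dots> = ennreal (2 * (1 + U)) * (\<integral>\<^sup>+ x\<in>{1..}. tail_series M X p r (x powr q) \<partial>lborel)"
    unfolding nn_integral_tail_series by (rule series_from_1_cmult)
  also have "\<dots> < \<infinity>" using fin[of 1] by (simp add: ennreal_mult_less_top)
  finally show ?thesis
    using tail_integral_moment_iff[OF Z p _ q, of r 2 1] r by simp
qed

end

lemma (in prob_space) moment_weight_integrable_powr:
  assumes [measurable]: "Z \<in> borel_measurable M"
    and fin: "(\<integral>\<^sup>+ \<omega>. ennreal (moment_weight p r q \<bar>Z \<omega>\<bar>) \<partial>M) < \<infinity>"
    and p: "0 < p" and r: "1 < r" and q: "0 < q" and s: "0 < s" "s \<le> p * r"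
  shows "integrable M (\<lambda>\<omega>. \<bar>Z \<omega>\<bar> powr s)"
proof -
  have le: "z powr s \<le> 1 + moment_weight p r q z" if z: "0 \<le> z" for z
  proof -
    have w0: "0 \<le> moment_weight p r q z" using log_plus_ge_1[of z] by (auto simp: moment_weight_def)
    show ?thesis
    proof (cases "z \<le> 1")
      case True
      then have "z powr s \<le> 1" using z s by (intro powr_le1) auto
      then show ?thesis using w0 by simp
    next
      case False
      have 1: "z powr s \<le> z powr (p * r)" using False s by (intro powr_mono) auto
      have 2: "z powr (p * r) \<le> z powr (1 / q)" if "q < 1 / (p * r)"
        using False that p r q by (intro powr_mono) (auto simp: field_simps)
      have 3: "z powr (p * r) * 1 \<le> z powr (p * r) * log_plus z"
        by (intro mult_left_mono log_plus_ge_1) auto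
      show ?thesis using 1 2 3 by (auto simp: moment_weight_def)
    qed
  qed
  have "(\<integral>\<^sup>+ \<omega>. ennreal (\<bar>Z \<omega>\<bar> powr s) \<partial>M) \<le> (\<integral>\<^sup>+ \<omega>. 1 + ennreal (moment_weight p r q \<bar>Z \<omega>\<bar>) \<partial>M)"
  proof (rule nn_integral_mono)
    fix \<omega>
    have "ennreal (\<bar>Z \<omega>\<bar> powr s) \<le> ennreal (1 + moment_weight p r q \<bar>Z \<omega>\<bar>)" by (intro ennreal_leI le) simp
    also have "\<dots> = 1 + ennreal (moment_weight p r q \<bar>Z \<omega>\<bar>)"
      using log_plus_ge_1[of "\<bar>Z \<omega>\<bar>"] by (subst ennreal_plus) (auto simp: moment_weight_def)
    finally show "ennreal (\<bar>Z \<omega>\<bar> powr s) \<le> 1 + ennreal (moment_weight p r q \<bar>Z \<omega>\<bar>)" .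
  qed
  also have "\<dots> = 1 + (\<integral>\<^sup>+ \<omega>. ennreal (moment_weight p r q \<bar>Z \<omega>\<bar>) \<partial>M)"
    by (subst nn_integral_add) (auto simp: emeasure_space_1)
  also have "\<dots> < \<infinity>" using fin by simp
  finally show ?thesis by (intro integrableI_nonneg) auto
qed

lemma (in prob_space) integrable_powr_diff_const:
  fixes c s :: real
  assumes [measurable]: "Z \<in> borel_measurable M" and i: "integrable M (\<lambda>\<omega>. \<bar>Z \<omega>\<bar> powr s)" and s: "0 < s"
  shows "integrable M (\<lambda>\<omega>. \<bar>Z \<omega> - c\<bar> powr s)"
proof (rule Bochner_Integration.integrable_bound)
  show "integrable M (\<lambda>\<omega>. 2 powr s * (\<bar>Z \<omega>\<bar> powr s + \<bar>c\<bar> powr s))" using i by simp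
  have "\<bar>z - c\<bar> powr s \<le> 2 powr s * (\<bar>z\<bar> powr s + \<bar>c\<bar> powr s)" for z :: real
  proof -
    have "\<bar>z - c\<bar> powr s \<le> (2 * max \<bar>z\<bar> \<bar>c\<bar>) powr s" using s by (intro powr_mono2) auto
    also have "\<dots> = 2 powr s * max \<bar>z\<bar> \<bar>c\<bar> powr s" by (simp add: powr_mult)
    also have "\<dots> \<le> 2 powr s * (\<bar>z\<bar> powr s + \<bar>c\<bar> powr s)"
      by (intro mult_left_mono) (auto simp: max_def)
    finally show ?thesis .
  qed
  then show "AE \<omega> in M. norm (\<bar>Z \<omega> - c\<bar> powr s) \<le> norm (2 powr s * (\<bar>Z \<omega>\<bar> powr s + \<bar>c\<bar> powr s))"
    by (intro always_eventually allI) (simp add: abs_of_nonneg add_nonneg_nonneg mult_nonneg_nonneg)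
qed measurable

context na_sequence
begin

text \<open>The sequences \<open>X n\<close> and \<open>X n - m\<close> both obey the law of large numbers with the norming \<open>n powr (1 / p)\<close>.
Their partial sums differ by \<open>n * m\<close>, which for \<open>p \<ge> 1\<close> is not of smaller order unless \<open>m = 0\<close>.\<close>

lemma mean_zero:
  assumes lim: "\<And>y. 0 < y \<Longrightarrow> (\<lambda>n. max_tail p n y) \<longlonglongrightarrow> 0"
    and i: "integrable M Z" and int_s: "integrable M (\<lambda>\<omega>. \<bar>Z \<omega>\<bar> powr s)"
    and p: "1 \<le> p" and s: "p < s" "s \<le> 2"
  shows "expectation Z = 0"
proof (rule ccontr)
  assume mu: "expectation Z \<noteq> 0"
  define m where "m = expectation Z"
  interpret c: na_sequence M "\<lambda>n \<omega>. X n \<omega> - m" "\<lambda>\<omega>. Z \<omega> - m" by (rule na_sequence_diff)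
  have mom: "centered_moment M s (\<lambda>\<omega>. Z \<omega> - m)"
    unfolding centered_moment_def using i int_s p s integrable_powr_diff_const[OF Z int_s, of m]
    by (auto simp: m_def prob_space)
  define y where "y = \<bar>m\<bar> / 3"
  have y: "0 < y" using mu by (simp add: y_def m_def)
  have "(\<lambda>n. c.max_tail p n y) \<longlonglongrightarrow> 0"
    by (rule c.max_tail_tendsto_0_centered[OF mom _ s(1) y]) (use p in simp)
  then have "\<forall>\<^sub>F n in sequentially. c.max_tail p n y < 1 / 2" by (rule order_tendstoD) simp
  moreover have "\<forall>\<^sub>F n in sequentially. max_tail p n y < 1 / 2"
    using lim[OF y] by (rule order_tendstoD) simp
  ultimately have "\<forall>\<^sub>F n in sequentially. c.max_tail p n y < 1 / 2 \<and> max_tail p n y < 1 / 2 \<and> n \<ge> 1"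
    by (intro eventually_conj eventually_ge_at_top)
  then obtain n where n: "c.max_tail p n y < 1 / 2" "max_tail p n y < 1 / 2" "n \<ge> 1"
    by (auto simp: eventually_sequentially)
  let ?A = "{\<omega> \<in> space M. max_partial_sum (\<lambda>n \<omega>. X n \<omega> - m) n \<omega> > y * real n powr (1 / p)}"
  let ?B = "{\<omega> \<in> space M. max_partial_sum X n \<omega> > y * real n powr (1 / p)}"
  have A: "?A \<in> sets M" using c.measurable_max_partial_sum[OF n(3)] by measurable
  have B: "?B \<in> sets M" using measurable_max_partial_sum[OF n(3)] by measurable
  have "prob (?A \<union> ?B) < 1" using measure_Un_le[OF A B] n by linarith
  then have "?A \<union> ?B \<noteq> space M" using prob_space by auto
  moreover have "?A \<union> ?B \<subseteq> space M" by auto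
  ultimately obtain \<omega> where w: "\<omega> \<in> space M" "\<omega> \<notin> ?A" "\<omega> \<notin> ?B" by auto
  have "\<bar>partial_sum (\<lambda>n \<omega>. X n \<omega> - m) n \<omega>\<bar> \<le> y * real n powr (1 / p)"
    using w n(3) by (auto simp: c.max_partial_sum_greater_iff not_less)
  moreover have "\<bar>partial_sum X n \<omega>\<bar> \<le> y * real n powr (1 / p)"
    using w n(3) by (auto simp: max_partial_sum_greater_iff not_less)
  moreover have "partial_sum (\<lambda>n \<omega>. X n \<omega> - m) n \<omega> = partial_sum X n \<omega> - real n * m"
    by (simp add: partial_sum_def sum_subtractf)
  ultimately have "\<bar>real n * m\<bar> \<le> 2 * (y * real n powr (1 / p))" by linarith
  also have "\<dots> \<le> 2 * (y * real n powr 1)"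
    using y p n(3) by (intro mult_left_mono powr_mono) auto
  also have "\<dots> < \<bar>real n * m\<bar>" using y n(3) by (simp add: y_def abs_mult)
  finally show False by simp
qed

theorem tail_integral_finite_iff:
  assumes p: "0 < p" "p < 2" and r: "1 < r" and q: "0 < q"
  shows "(\<forall>\<epsilon>>0. (\<integral>\<^sup>+ x\<in>{\<epsilon>..}. tail_series M X p r (x powr q) \<partial>lborel) < \<infinity>) \<longleftrightarrow>
    (\<integral>\<^sup>+ \<omega>. ennreal (moment_weight p r q \<bar>Z \<omega>\<bar>) \<partial>M) < \<infinity> \<and>
    (1 \<le> p \<longrightarrow> integrable M Z \<and> expectation Z = 0)"
proof
  \<comment> \<open>An order strictly above \<open>p\<close>, available from the moment condition, at most \<open>2\<close>, and at most \<open>1\<close>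
    for \<open>p < 1\<close>, where the mean is not assumed to vanish.\<close>
  define s where "s = (if 1 \<le> p then min (p * r) 2 else min (p * r) 1)"
  have pr: "p < p * r" using p r by simp
  have s: "p < s" "s \<le> p * r" "s \<le> 2" "0 < s" using p pr by (auto simp: s_def)
  {
    assume R: "(\<integral>\<^sup>+ \<omega>. ennreal (moment_weight p r q \<bar>Z \<omega>\<bar>) \<partial>M) < \<infinity> \<and>
      (1 \<le> p \<longrightarrow> integrable M Z \<and> expectation Z = 0)"
    then have "centered_moment M s Z"
      unfolding centered_moment_def
      using moment_weight_integrable_powr[OF Z _ p(1) r q s(4,2)] s by (auto simp: s_def)
    then show "\<forall>\<epsilon>>0. (\<integral>\<^sup>+ x\<in>{\<epsilon>..}. tail_series M X p r (x powr q) \<partial>lborel) < \<infinity>"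
      using nn_integral_tail_series_finite[OF _ p(1) s(1) r q] R by blast
  }
  assume L: "\<forall>\<epsilon>>0. (\<integral>\<^sup>+ x\<in>{\<epsilon>..}. tail_series M X p r (x powr q) \<partial>lborel) < \<infinity>"
  then have fin: "\<And>\<epsilon>::real. 0 < \<epsilon> \<Longrightarrow> (\<integral>\<^sup>+ x\<in>{\<epsilon>..}. tail_series M X p r (x powr q) \<partial>lborel) < \<infinity>" by blast
  have mw: "(\<integral>\<^sup>+ \<omega>. ennreal (moment_weight p r q \<bar>Z \<omega>\<bar>) \<partial>M) < \<infinity>"
    by (rule moment_weight_finite[OF fin p(1) r q])
  have "integrable M Z \<and> expectation Z = 0" if "1 \<le> p"
  proof -
    have "integrable M (\<lambda>\<omega>. \<bar>Z \<omega>\<bar> powr 1)"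
      by (rule moment_weight_integrable_powr[OF Z mw p(1) r q]) (use that pr in linarith)+
    then have i: "integrable M Z" by (intro integrable_norm_cancel[OF _ Z]) simp
    moreover have "expectation Z = 0"
      by (rule mean_zero[OF max_tail_tendsto_0[OF tail_series_finite[OF fin q] p(1) r] i
            moment_weight_integrable_powr[OF Z mw p(1) r q s(4,2)] that s(1,3)])
    ultimately show ?thesis by simp
  qed
  with mw show "(\<integral>\<^sup>+ \<omega>. ennreal (moment_weight p r q \<bar>Z \<omega>\<bar>) \<partial>M) < \<infinity> \<and>
    (1 \<le> p \<longrightarrow> integrable M Z \<and> expectation Z = 0)" by blast
qed

end

section \<open>The equivalence of the three conditions\<close>

theorem theorem2p1:
  fixes M :: "'a measure"
    and X :: "nat \<Rightarrow> 'a \<Rightarrow> real"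
    and X' :: "'a \<Rightarrow> real"
    and p r q :: real
    and f :: "real \<Rightarrow> ennreal"
  assumes "prob_space M"
    and "\<And>n. n \<ge> 1 \<Longrightarrow> X n \<in> borel_measurable M"
    and "X' \<in> borel_measurable M"
    and "\<And>n. n \<ge> 1 \<Longrightarrow> distr M borel (X n) = distr M borel X'"
    and "negatively_associated M {1..} X"
    and "0 < p" and "p < 2" and "r > 1" and "q > 0"
    and f_def: "\<And>x. x > 0 \<Longrightarrow> f x = tail_series M X p r x"
  defines "cond_i \<equiv>
      \<forall>\<epsilon>>0. series_from_1 (\<lambda>n. ennreal (real n powr (r - 2 - 1 / (p * q))) *
        (\<integral>\<^sup>+ \<omega>. ennreal (max 0 (max_partial_sum X n \<omega> powr (1 / q)
                             - \<epsilon> * real n powr (1 / (p * q)))) \<partial>M)) < \<infinity>"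
    and "cond_ii \<equiv> \<forall>\<epsilon>>0::real. (\<integral>\<^sup>+ x \<in> {\<epsilon>..}. f (x powr q) \<partial>lborel) < \<infinity>"
    and "cond_iii \<equiv>
      (q < 1 / (p * r) \<longrightarrow> (\<integral>\<^sup>+ \<omega>. ennreal (\<bar>X' \<omega>\<bar> powr (1 / q)) \<partial>M) < \<infinity>) \<and>
      (q = 1 / (p * r) \<longrightarrow>
        (\<integral>\<^sup>+ \<omega>. ennreal (\<bar>X' \<omega>\<bar> powr (p * r) * log_plus \<bar>X' \<omega>\<bar>) \<partial>M) < \<infinity>) \<and>
      (q > 1 / (p * r) \<longrightarrow> (\<integral>\<^sup>+ \<omega>. ennreal (\<bar>X' \<omega>\<bar> powr (p * r)) \<partial>M) < \<infinity>) \<and>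
      (1 \<le> p \<longrightarrow> integrable M X' \<and> (LINT \<omega>|M. X' \<omega>) = 0)"
  shows "(cond_i \<longleftrightarrow> cond_ii) \<and> (cond_ii \<longleftrightarrow> cond_iii)"
proof -
  interpret na_sequence M X X'
    using assms(1-5) by (intro na_sequence.intro na_sequence_axioms.intro)
  have f_eq: "(\<integral>\<^sup>+ x\<in>{\<epsilon>..}. f (x powr q) \<partial>lborel) =
      (\<integral>\<^sup>+ x\<in>{\<epsilon>..}. tail_series M X p r (x powr q) \<partial>lborel)" if "0 < \<epsilon>" for \<epsilon> :: real
  proof (rule nn_integral_cong)
    fix x :: real
    show "f (x powr q) * indicator {\<epsilon>..} x = tail_series M X p r (x powr q) * indicator {\<epsilon>..} x"
    proof (cases "\<epsilon> \<le> x")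
      case True
      then have "0 < x powr q" using that by simp
      then show ?thesis by (simp add: f_def)
    qed simp
  qed
  have "cond_i \<longleftrightarrow> cond_ii"
    unfolding cond_i_def cond_ii_def
    using excess_series_eq_nn_integral_tail_series[OF _ \<open>q > 0\<close>, of _ r p] f_eq by simp
  moreover have "cond_ii \<longleftrightarrow> (\<integral>\<^sup>+ \<omega>. ennreal (moment_weight p r q \<bar>X' \<omega>\<bar>) \<partial>M) < \<infinity> \<and>
      (1 \<le> p \<longrightarrow> integrable M X' \<and> expectation X' = 0)"
    unfolding cond_ii_def
    using tail_integral_finite_iff[OF \<open>0 < p\<close> \<open>p < 2\<close> \<open>r > 1\<close> \<open>q > 0\<close>] f_eq by simp
  moreover have "cond_iii \<longleftrightarrow> (\<integral>\<^sup>+ \<omega>. ennreal (moment_weight p r q \<bar>X' \<omega>\<bar>) \<partial>M) < \<infinity> \<and>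
      (1 \<le> p \<longrightarrow> integrable M X' \<and> expectation X' = 0)"
  proof -
    consider "q < 1 / (p * r)" | "q = 1 / (p * r)" | "q > 1 / (p * r)" by linarith
    then show ?thesis by cases (auto simp: cond_iii_def moment_weight_def)
  qed
  ultimately show ?thesis by blast
qed

end
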